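(* Let $d\in\mathbb{N}$, let $W\subset\mathbb{R}^d$ be a non-empty bounded open set and let $\Phi_1,\Phi_2,\ldots$ be independent and identically distributed point processes on $\mathbb{R}^d$ observed in $W$, with well-defined intensity function $\lambda$ and pair correlation function $g$. Suppose that $g:W\times W\to\mathbb{R}$ is bounded and that $\lambda:W\to(\underline\lambda,\bar\lambda)$, with $0<\underline\lambda<\bar\lambda<\infty$, is bounded, bounded away from zero and five times continuously differentiable on $W$ with bounded partial derivatives. Let $\gamma>5$ and let $(h_n)_{n\in\mathbb{N}}$ be a sequence of positive bandwidths with $h_n\to0$ and $nh_n^d\to\infty$ as $n\to\infty$. For $x_0\in W$ consider the adaptive estimator \[ \tilde\lambda(x_0)=\frac1n\sum_{i=1}^n\sum_{y\in\Phi_i\cap W}\frac{c(y)^d}{h_n^d}\,\kappa^\gamma\Big(\frac{x_0-y}{h_n}\,c(y)\Big),\qquad c(x)=\sqrt{\frac{\lambda(x)}{\lambda(x_0)}},\quad x\in W, \] where $\kappa^\gamma$ is the Beta kernel. Then, as $n\to\infty$, \[ \mathrm{mse}\,\tilde\lambda(x_0)=\lambda(x_0)^2\Big(\int_{\mathbb{R}^d}A(u;x_0)\,du\Big)^2h_n^8+\frac{\lambda(x_0)Q(d,\gamma)}{nh_n^d}+o(h_n^8)+O\Big(\frac{1}{nh_n^{d-1}}\Big). \] The asymptotic mean squared error is optimised at \[ h_n^*(x_0)=\frac{1}{n^{1/(d+8)}}\left(\frac{d\,Q(d,\gamma)}{8\,\lambda(x_0)\big(\int_{\mathbb{R}^d}A(u;x_0)\,du\big)^2}\right)^{1/(d+8)}.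 \]
   Context: Point processes: the factorial moment measures of $\Phi_1$ of first and second order exist (as locally finite measures) and, on $W$ and $W\times W$ respectively, are absolutely continuous with respect to Lebesgue measure with densities $\lambda$ (the intensity function) and $\rho^{(2)}$ (the second order product density). That is, $\mathbb{E}\sum_{y\in\Phi_1\cap W}f(y)=\int_W f\lambda\,du$ and $\mathbb{E}\sum_{y\ne z\in\Phi_1\cap W}f(y,z)=\int_{W^2}f\rho^{(2)}\,du\,dv$ for non-negative measurable $f$. The pair correlation function is $g(u,v)=\rho^{(2)}(u,v)/(\lambda(u)\lambda(v))$ for $u,v\in W$ (not to be confused with the functions $g_u$ below). Beta kernel: for $\gamma\ge0$, $\kappa^\gamma(x)=c(d,\gamma)^{-1}(1-x^Tx)^\gamma\,1\{x\in b(0,1)\}$, $x\in\mathbb{R}^d$, where $b(0,1)$ is the closed unit ball of $\mathbb{R}^d$ centred at the origin and $c(d,\gamma)=\int_{b(0,1)}(1-x^Tx)^\gamma dx=\pi^{d/2}\Gamma(\gamma+1)/\Gamma(d/2+\gamma+1)$ (a normalising constant, not to be confused with the weight function $c(\cdot)$). Constant: $Q(d,\gamma)=\int_{\mathbb{R}^d}\kappa^\gamma(x)^2dx=c(d,2\gamma)/c(d,\gamma)^2$. Function $A$: with $g_u(v)=v^{d+2}\kappa^\gamma(vu)$ for $v\in\mathbb{R}$, $u\in\mathbb{R}^d$, and $D^kg_u(1)$ the $k$-th derivative of $v\mapsto g_u(v)$ at $v=1$, \begin{align*} A(u;x_0)={}&\frac{Dg_u(1)}{24}D^4c(x_0)(u,u,u,u)+\frac{D^4g_u(1)}{24}\big(Dc(x_0)u\big)^4\\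 &+\frac{D^2g_u(1)}{2}\Big\{\frac13\,Dc(x_0)u\;D^3c(x_0)(u,u,u)+\frac14\big(D^2c(x_0)(u,u)\big)^2\Big\}\\ &+\frac{D^3g_u(1)}{4}\big(Dc(x_0)u\big)^2D^2c(x_0)(u,u), \end{align*} where $D^rc(x)(u,\dots,u)=\sum_{j_1,\dots,j_r=1}^d u_{j_1}\cdots u_{j_r}D_{j_1\cdots j_r}c(x)$, $Dc(x)u=\sum_j u_jD_jc(x)$, and $D_{j_1\cdots j_r}$ denotes $r$-th order partial derivatives. The mean squared error is $\mathrm{mse}\,\tilde\lambda(x_0)=\mathbb{E}\big[(\tilde\lambda(x_0)-\lambda(x_0))^2\big]$. The asymptotic mean squared error, as a function of the bandwidth $h>0$ for fixed $n$, is the sum of the leading terms $\lambda(x_0)^2\big(\int_{\mathbb{R}^d} A(u;x_0)du\big)^2h^8+\frac{\lambda(x_0)Q(d,\gamma)}{nh^d}$; optimised means minimised over $h>0$. *)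

theory Defs
  imports "HOL-Probability.Probability" "HOL-Library.Landau_Symbols"
begin

text \<open>A point process is a random locally finite subset, measurable for the sigma-algebra
  generated by the numbers of points in bounded Borel sets.\<close>

definition locally_finite_configs :: "'a::euclidean_space set set" where
  "locally_finite_configs = {x. \<forall>B. bounded B \<longrightarrow> finite (x \<inter> B)}"

definition config_space :: "'a::euclidean_space set measure" where
  "config_space = sigma locally_finite_configs
     {{x \<in> locally_finite_configs. card (x \<inter> B) = k} | B k. B \<in> sets borel \<and> bounded B}"

definition point_process :: "'w measure \<Rightarrow> ('w \<Rightarrow> 'a::euclidean_space set) \<Rightarrow> bool" where
  "point_process M X \<longleftrightarrow> prob_space M \<and> X \<in> measurable M config_space"

definition iid_point_processes ::
  "'w measure \<Rightarrow> (nat \<Rightarrow> 'w \<Rightarrow> 'a::euclidean_space set) \<Rightarrow> nat set \<Rightarrow> bool" where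
  "iid_point_processes M \<Phi> I \<longleftrightarrow>
     (\<forall>i\<in>I. point_process M (\<Phi> i)) \<and>
     prob_space.indep_vars M (\<lambda>_. config_space) \<Phi> I \<and>
     (\<forall>i\<in>I. \<forall>j\<in>I. distr M config_space (\<Phi> i) = distr M config_space (\<Phi> j))"

definition factorial_moment1 ::
  "'w measure \<Rightarrow> ('w \<Rightarrow> 'a::euclidean_space set) \<Rightarrow> 'a set \<Rightarrow> ennreal" where
  "factorial_moment1 M X B = (\<integral>\<^sup>+\<omega>. emeasure (count_space UNIV) (X \<omega> \<inter> B) \<partial>M)"

definition distinct_pairs :: "'a set \<Rightarrow> ('a \<times> 'a) set" where
  "distinct_pairs S = {(y, z). y \<in> S \<and> z \<in> S \<and> y \<noteq> z}"

definition factorial_moment2 ::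
  "'w measure \<Rightarrow> ('w \<Rightarrow> 'a::euclidean_space set) \<Rightarrow> ('a \<times> 'a) set \<Rightarrow> ennreal" where
  "factorial_moment2 M X C =
     (\<integral>\<^sup>+\<omega>. emeasure (count_space UNIV) (distinct_pairs (X \<omega>) \<inter> C) \<partial>M)"

definition locally_finite_factorial_moments ::
  "'w measure \<Rightarrow> ('w \<Rightarrow> 'a::euclidean_space set) \<Rightarrow> bool" where
  "locally_finite_factorial_moments M X \<longleftrightarrow>
     (\<forall>B\<in>sets borel. bounded B \<longrightarrow> factorial_moment1 M X B < \<infinity>) \<and>
     (\<forall>C\<in>sets borel. bounded C \<longrightarrow> factorial_moment2 M X C < \<infinity>)"

text \<open>The integrals with respect to \<^const>\<open>count_space\<close> below are the sums over the points,
  respectively the pairs of distinct points, of the process in \<open>W\<close>.\<close>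

definition intensity_function_on ::
  "'w measure \<Rightarrow> ('w \<Rightarrow> 'a::euclidean_space set) \<Rightarrow> 'a set \<Rightarrow> ('a \<Rightarrow> real) \<Rightarrow> bool" where
  "intensity_function_on M X W lam \<longleftrightarrow>
     lam \<in> borel_measurable (restrict_space lborel W) \<and>
     (\<forall>u\<in>W. 0 \<le> lam u) \<and>
     (\<forall>f\<in>borel_measurable borel.
        (\<integral>\<^sup>+\<omega>. (\<integral>\<^sup>+y. f y \<partial>count_space (X \<omega> \<inter> W)) \<partial>M)
          = (\<integral>\<^sup>+u\<in>W. f u * ennreal (lam u) \<partial>lborel))"

definition product_density_on ::
  "'w measure \<Rightarrow> ('w \<Rightarrow> 'a::euclidean_space set) \<Rightarrow> 'a set \<Rightarrow> ('a \<Rightarrow> 'a \<Rightarrow> real) \<Rightarrow> bool" where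
  "product_density_on M X W rho \<longleftrightarrow>
     case_prod rho \<in> borel_measurable (restrict_space lborel (W \<times> W)) \<and>
     (\<forall>u\<in>W. \<forall>v\<in>W. 0 \<le> rho u v) \<and>
     (\<forall>f\<in>borel_measurable borel.
        (\<integral>\<^sup>+\<omega>. (\<integral>\<^sup>+p. f p \<partial>count_space (distinct_pairs (X \<omega> \<inter> W))) \<partial>M)
          = (\<integral>\<^sup>+p\<in>W \<times> W. f p * ennreal (rho (fst p) (snd p)) \<partial>lborel))"

definition pair_correlation ::
  "('a \<Rightarrow> real) \<Rightarrow> ('a \<Rightarrow> 'a \<Rightarrow> real) \<Rightarrow> 'a \<Rightarrow> 'a \<Rightarrow> real" where
  "pair_correlation lam rho u v = rho u v / (lam u * lam v)"

definition partial_deriv :: "'a::euclidean_space \<Rightarrow> ('a \<Rightarrow> real) \<Rightarrow> 'a \<Rightarrow> real" where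
  "partial_deriv b f x = deriv (\<lambda>t. f (x + t *\<^sub>R b)) 0"

text \<open>The list \<open>[b\<^sub>1, \<dots>, b\<^sub>r]\<close> of basis vectors plays the role of the index tuple
  \<open>j\<^sub>1 \<dots> j\<^sub>r\<close>.\<close>

fun partials :: "'a::euclidean_space list \<Rightarrow> ('a \<Rightarrow> real) \<Rightarrow> 'a \<Rightarrow> real" where
  "partials [] f = f"
| "partials (b # bs) f = partial_deriv b (partials bs f)"

definition basis_tuples :: "nat \<Rightarrow> 'a::euclidean_space list set" where
  "basis_tuples r = {bs. set bs \<subseteq> Basis \<and> length bs = r}"

definition times_cont_differentiable_on ::
  "nat \<Rightarrow> ('a::euclidean_space \<Rightarrow> real) \<Rightarrow> 'a set \<Rightarrow> bool" where
  "times_cont_differentiable_on k f W \<longleftrightarrow>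
     (\<forall>r<k. \<forall>bs\<in>basis_tuples r. \<forall>b\<in>Basis. \<forall>x\<in>W.
        (\<lambda>t. partials bs f (x + t *\<^sub>R b)) field_differentiable (at 0)) \<and>
     (\<forall>r\<le>k. \<forall>bs\<in>basis_tuples r. continuous_on W (partials bs f))"

definition bounded_partials_on ::
  "nat \<Rightarrow> ('a::euclidean_space \<Rightarrow> real) \<Rightarrow> 'a set \<Rightarrow> bool" where
  "bounded_partials_on k f W \<longleftrightarrow>
     (\<forall>r\<in>{1..k}. \<forall>bs\<in>basis_tuples r. bounded (partials bs f ` W))"

definition diff_form :: "nat \<Rightarrow> ('a::euclidean_space \<Rightarrow> real) \<Rightarrow> 'a \<Rightarrow> 'a \<Rightarrow> real" where
  "diff_form r f x u =
     (\<Sum>bs\<in>basis_tuples r. prod_list (map (\<lambda>b. u \<bullet> b) bs) * partials bs f x)"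

text \<open>As \<open>0 powr 0 = 0\<close>, for \<open>\<gamma> = 0\<close> the kernel vanishes on the unit sphere (a null set)
  instead of being constant on the closed ball; for \<open>\<gamma> > 0\<close> the value there is \<open>0\<close> anyway.\<close>

definition beta_const :: "'a::euclidean_space itself \<Rightarrow> real \<Rightarrow> real" where
  "beta_const _ \<gamma> = (LINT x:cball (0::'a) 1|lborel. (1 - x \<bullet> x) powr \<gamma>)"

definition beta_kernel :: "real \<Rightarrow> 'a::euclidean_space \<Rightarrow> real" where
  "beta_kernel \<gamma> x =
     (1 - x \<bullet> x) powr \<gamma> * indicator (cball 0 1) x / beta_const TYPE('a) \<gamma>"

definition beta_Q :: "'a::euclidean_space itself \<Rightarrow> real \<Rightarrow> real" where
  "beta_Q _ \<gamma> = (LINT x|lborel. (beta_kernel \<gamma> (x::'a))\<^sup>2)"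

definition weight :: "('a \<Rightarrow> real) \<Rightarrow> 'a \<Rightarrow> 'a \<Rightarrow> real" where
  "weight lam x0 x = sqrt (lam x / lam x0)"

definition g_fun :: "real \<Rightarrow> 'a::euclidean_space \<Rightarrow> real \<Rightarrow> real" where
  "g_fun \<gamma> u v = v ^ (DIM('a) + 2) * beta_kernel \<gamma> (v *\<^sub>R u)"

definition A_fun ::
  "real \<Rightarrow> ('a::euclidean_space \<Rightarrow> real) \<Rightarrow> 'a \<Rightarrow> 'a \<Rightarrow> real" where
  "A_fun \<gamma> lam x0 u =
    (let Dg = (\<lambda>k. (deriv ^^ k) (g_fun \<gamma> u) 1);
         Dc = (\<lambda>r. diff_form r (weight lam x0) x0 u)
     in Dg 1 / 24 * Dc 4 + Dg 4 / 24 * (Dc 1) ^ 4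
        + Dg 2 / 2 * (1 / 3 * Dc 1 * Dc 3 + 1 / 4 * (Dc 2)\<^sup>2)
        + Dg 3 / 4 * (Dc 1)\<^sup>2 * Dc 2)"

definition adaptive_estimator ::
  "real \<Rightarrow> ('a::euclidean_space \<Rightarrow> real) \<Rightarrow> 'a set \<Rightarrow> (nat \<Rightarrow> 'w \<Rightarrow> 'a set) \<Rightarrow>
     'a \<Rightarrow> nat \<Rightarrow> real \<Rightarrow> 'w \<Rightarrow> real" where
  "adaptive_estimator \<gamma> lam W \<Phi> x0 n h \<omega> =
     1 / real n * (\<Sum>i\<in>{1..n}. \<Sum>y\<in>\<Phi> i \<omega> \<inter> W.
       weight lam x0 y ^ DIM('a) / h ^ DIM('a)
         * beta_kernel \<gamma> (weight lam x0 y *\<^sub>R ((x0 - y) /\<^sub>R h)))"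

definition mse :: "'w measure \<Rightarrow> ('w \<Rightarrow> real) \<Rightarrow> real \<Rightarrow> real" where
  "mse M T \<theta> = (LINT \<omega>|M. (T \<omega> - \<theta>)\<^sup>2)"

end

theory Submission
  imports Defs
begin

text \<open>Since the \<open>\<Phi>\<^sub>i\<close> are independent copies, the estimator is an average of \<open>n\<close> independent copies of
  \<open>S = \<Sum>\<^sub>y F(y)\<close>, where \<open>y\<close> runs through the points in \<open>W\<close>, and
  \<open>mse = Var S / n + (E S - \<lambda>(x\<^sub>0))\<^sup>2\<close> (\<open>mse_average_of_indep\<close>). The intensity function turns \<open>E S\<close> into an
  integral of \<open>F \<lambda>\<close>; the second order product density turns \<open>E S\<^sup>2\<close> into the integral of \<open>F\<^sup>2 \<lambda>\<close>, coming from
  the diagonal pairs, plus a term that is at most a constant times \<open>(E S)\<^sup>2\<close> because \<open>g\<close> is bounded.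

  Both integrals become transparent after the substitution \<open>y = x\<^sub>0 + h u\<close>. As \<open>\<lambda> = \<lambda>(x\<^sub>0) c\<^sup>2\<close>, one gets
  \<open>E S = \<lambda>(x\<^sub>0) \<integral> g\<^sub>u(c(x\<^sub>0 + h u)) du\<close>, and the diagonal term is \<open>h\<^sup>-\<^sup>d \<lambda>(x\<^sub>0)\<close> times an integral of the same
  shape with \<open>v ^ (2d + 2) \<kappa>(v u)\<^sup>2\<close> in place of \<open>g\<^sub>u(v)\<close> (\<open>nn_integral_rescaled_profile\<close>). The integration may be
  restricted to a fixed cube, since \<open>c\<close> is bounded away from zero on \<open>W\<close> and \<open>\<kappa>\<close> has compact support. On this cube
  everything is differentiable in \<open>h\<close> up to order four, with continuous derivatives: \<open>\<gamma> > 4\<close> gives four continuous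
  derivatives of \<open>v \<mapsto> g\<^sub>u(v)\<close>, also across the boundary of the support, and the smoothness of \<open>\<lambda>\<close> passes to \<open>c\<close>.
  Differentiation under the integral sign therefore yields Taylor expansions in \<open>h\<close>
  (\<open>taylor_integral_line_deriv\<close>).

  For the variance, the first derivative suffices: the integral is \<open>Q + O(h)\<close>. For the bias, the expansion to order
  four has the constant term \<open>1\<close>, the integral of \<open>\<kappa>\<close>. The terms of odd order vanish by the symmetry \<open>u \<mapsto> -u\<close>. The term
  of order two is where the choice \<open>c\<^sup>2 \<propto> \<lambda>\<close> matters: it is the integral of
  \<open>D\<^sup>2g\<^sub>u(1) (Dc u)\<^sup>2 + Dg\<^sub>u(1) D\<^sup>2c(u, u)\<close>, and for a quadratic form \<open>f\<close> the integral of \<open>f(u) g\<^sub>u(v)\<close> does not depend on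
  \<open>v\<close>, because the factor \<open>v ^ (d + 2)\<close> in \<open>g\<^sub>u(v)\<close> is exactly compensated by scaling \<open>u\<close>; so its \<open>v\<close>-derivatives are zero
  (\<open>profile_moment_derivs\<close>). The term of order four is the integral of \<open>A\<close> by the chain rule for fourth
  derivatives (\<open>A_fun_eq_line_deriv\<close>). Hence the bias is \<open>\<lambda>(x\<^sub>0) h\<^sup>4 \<integral> A + o(h\<^sup>4)\<close> (\<open>bias_expansion\<close>).

  The optimal bandwidth follows from \<open>ln x \<le> x - 1\<close> (\<open>is_arg_min_bias_variance\<close>).\<close>

section \<open>Moments of sums over a point process\<close>

lemma space_config_space: "space config_space = locally_finite_configs"
  unfolding config_space_def by (rule space_measure_of_conv)

lemma measurable_card_points:
  fixes B :: "'a::euclidean_space set"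
  assumes "B \<in> sets borel" "bounded B"
  shows "(\<lambda>x. card (x \<inter> B)) \<in> measurable config_space (count_space UNIV)"
proof (subst measurable_count_space_eq2_countable, safe)
  fix k :: nat
  have "(\<lambda>x. card (x \<inter> B)) -` {k} \<inter> space config_space = {x \<in> locally_finite_configs. card (x \<inter> B) = k}"
    by (auto simp: space_config_space)
  also have "\<dots> \<in> sets config_space"
    unfolding config_space_def using assms
    by (intro in_measure_of) auto
  finally show "(\<lambda>x. card (x \<inter> B)) -` {k} \<inter> space config_space \<in> sets config_space" .
qed auto

lemma finite_points:
  "x \<in> locally_finite_configs \<Longrightarrow> bounded B \<Longrightarrow> finite (x \<inter> B)"
  by (auto simp: locally_finite_configs_def)

text \<open>The counts in bounded Borel sets generate the sigma-algebra on configurations, so the claim holds for indicators, and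
  it extends to all measurable functions by linearity and monotone limits. Boundedness of \<open>W\<close> keeps the counts finite.\<close>

lemma measurable_points_integral:
  fixes f :: "'a::euclidean_space \<Rightarrow> ennreal"
  assumes f: "f \<in> borel_measurable borel" and W: "W \<in> sets borel" "bounded W"
  shows "(\<lambda>x. \<integral>\<^sup>+y. f y \<partial>count_space (x \<inter> W)) \<in> borel_measurable config_space"
  using f
proof (induction rule: borel_measurable_induct)
  case (cong f g)
  then have "f = g" by auto
  with cong show ?case by simp
next
  case (set A)
  have "(\<lambda>x. ennreal (real (card (x \<inter> (A \<inter> W))))) \<in> borel_measurable config_space"
    using measurable_compose[OF measurable_card_points[of "A \<inter> W"], of "\<lambda>n. ennreal (real n)" borel]
      set W by (auto intro: bounded_subset)
  also have "?this \<longleftrightarrow> ?case"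
  proof (intro measurable_cong)
    fix x :: "'a set" assume "x \<in> space config_space"
    then have fin: "finite (x \<inter> (A \<inter> W))"
      using W by (auto simp: space_config_space intro!: finite_points intro: bounded_subset)
    have "(\<integral>\<^sup>+y. indicator A y \<partial>count_space (x \<inter> W)) = emeasure (count_space (x \<inter> W)) (A \<inter> (x \<inter> W))"
      by (subst nn_integral_indicator') auto
    also have "A \<inter> (x \<inter> W) = x \<inter> (A \<inter> W)" by auto
    also have "emeasure (count_space (x \<inter> W)) (x \<inter> (A \<inter> W)) = ennreal (real (card (x \<inter> (A \<inter> W))))"
      using fin by (subst emeasure_count_space_finite) (auto simp: ennreal_of_nat_eq_real_of_nat)
    finally show "ennreal (real (card (x \<inter> (A \<inter> W)))) = (\<integral>\<^sup>+y. indicator A y \<partial>count_space (x \<inter> W))" by simp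
  qed
  finally show ?case .
next
  case (mult u c)
  then show ?case by (simp add: nn_integral_cmult)
next
  case (add u v)
  then show ?case by (simp add: nn_integral_add)
next
  case (seq U)
  have "(\<integral>\<^sup>+y. (SUP i. U i) y \<partial>count_space (x \<inter> W)) = (SUP i. \<integral>\<^sup>+y. U i y \<partial>count_space (x \<inter> W))" for x
    unfolding SUP_apply using seq by (intro nn_integral_monotone_convergence_SUP) auto
  with seq show ?case by simp
qed

lemma points_integral_eq_sum:
  fixes f :: "'a \<Rightarrow> real"
  assumes "finite A" "\<And>y. y \<in> A \<Longrightarrow> 0 \<le> f y"
  shows "(\<integral>\<^sup>+y. ennreal (f y) \<partial>count_space A) = ennreal (\<Sum>y\<in>A. f y)"
  using assms by (subst nn_integral_count_space_finite) auto

lemma measurable_points_sum: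
  fixes f :: "'a::euclidean_space \<Rightarrow> real"
  assumes f: "f \<in> borel_measurable borel" "\<And>y. 0 \<le> f y" and W: "W \<in> sets borel" "bounded W"
  shows "(\<lambda>x. \<Sum>y\<in>x \<inter> W. f y) \<in> borel_measurable config_space"
proof -
  have "(\<lambda>x. enn2real (\<integral>\<^sup>+y. ennreal (f y) \<partial>count_space (x \<inter> W))) \<in> borel_measurable config_space"
    using f W by (intro measurable_compose[OF measurable_points_integral]) auto
  also have "?this \<longleftrightarrow> ?thesis"
    using f W by (intro measurable_cong)
      (auto simp: points_integral_eq_sum space_config_space finite_points sum_nonneg)
  finally show ?thesis .
qed

lemma sum_square_eq_diagonal_plus_distinct:
  fixes f :: "'a \<Rightarrow> real"
  assumes "finite A"
  shows "(\<Sum>y\<in>A. f y)\<^sup>2 = (\<Sum>y\<in>A. (f y)\<^sup>2) + (\<Sum>p\<in>distinct_pairs A. f (fst p) * f (snd p))"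
proof -
  have "(\<Sum>y\<in>A. f y)\<^sup>2 = (\<Sum>p\<in>A \<times> A. f (fst p) * f (snd p))"
    by (simp add: power2_eq_square sum_product sum.cartesian_product case_prod_beta)
  also have "A \<times> A = (\<lambda>y. (y, y)) ` A \<union> distinct_pairs A"
    by (auto simp: distinct_pairs_def)
  also have "(\<Sum>p\<in>\<dots>. f (fst p) * f (snd p)) =
      (\<Sum>p\<in>(\<lambda>y. (y, y)) ` A. f (fst p) * f (snd p)) + (\<Sum>p\<in>distinct_pairs A. f (fst p) * f (snd p))"
    using assms finite_subset[of "distinct_pairs A" "A \<times> A"]
    by (intro sum.union_disjoint) (auto simp: distinct_pairs_def)
  also have "(\<Sum>p\<in>(\<lambda>y. (y, y)) ` A. f (fst p) * f (snd p)) = (\<Sum>y\<in>A. (f y)\<^sup>2)"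
    by (subst sum.reindex) (auto simp: inj_on_def power2_eq_square)
  finally show ?thesis .
qed

text \<open>The integrals over \<open>W\<close> are passed as real numbers \<open>m1\<close>, \<open>m2\<close> and \<open>m12\<close>, which records that they are finite and so
  yields integrability of \<open>S\<close> and \<open>S\<^sup>2\<close> at the same time. The square \<open>S\<^sup>2\<close> splits into the sum over the diagonal,
  governed by the intensity, and the sum over distinct pairs, governed by the product density.\<close>

lemma points_sum_moments:
  fixes X :: "'w \<Rightarrow> 'a::euclidean_space set" and F :: "'a \<Rightarrow> real"
  assumes W: "W \<in> sets borel" "bounded W"
    and X: "point_process M X"
    and lam: "intensity_function_on M X W lam"
    and rho: "product_density_on M X W rho"
    and F[measurable]: "F \<in> borel_measurable borel" and F0: "\<And>y. 0 \<le> F y"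
    and m1: "(\<integral>\<^sup>+u\<in>W. ennreal (F u) * ennreal (lam u) \<partial>lborel) = ennreal m1" "0 \<le> m1"
    and m2: "(\<integral>\<^sup>+u\<in>W. ennreal ((F u)\<^sup>2) * ennreal (lam u) \<partial>lborel) = ennreal m2" "0 \<le> m2"
    and m12: "(\<integral>\<^sup>+p\<in>W \<times> W. ennreal (F (fst p) * F (snd p)) * ennreal (rho (fst p) (snd p)) \<partial>lborel)
       = ennreal m12" "0 \<le> m12"
  defines "S \<equiv> \<lambda>\<omega>. \<Sum>y\<in>X \<omega> \<inter> W. F y"
  shows "has_bochner_integral M S m1"
    and "has_bochner_integral M (\<lambda>\<omega>. (S \<omega>)\<^sup>2) (m2 + m12)"
proof -
  have X_meas[measurable]: "X \<in> measurable M config_space"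
    using X by (simp add: point_process_def)
  have fin: "finite (X \<omega> \<inter> W)" if "\<omega> \<in> space M" for \<omega>
    using measurable_space[OF X_meas that] W by (auto simp: space_config_space finite_points)
  have S_meas[measurable]: "S \<in> borel_measurable M"
    unfolding S_def using measurable_compose[OF X_meas measurable_points_sum[OF F F0 W]] .
  have Q_meas[measurable]: "(\<lambda>\<omega>. \<Sum>y\<in>X \<omega> \<inter> W. (F y)\<^sup>2) \<in> borel_measurable M"
    by (rule measurable_compose[OF X_meas measurable_points_sum[OF _ _ W]]) auto
  have S0: "0 \<le> S \<omega>" for \<omega> unfolding S_def by (intro sum_nonneg F0)
  have "(\<integral>\<^sup>+\<omega>. ennreal (S \<omega>) \<partial>M) = (\<integral>\<^sup>+\<omega>. (\<integral>\<^sup>+y. ennreal (F y) \<partial>count_space (X \<omega> \<inter> W)) \<partial>M)"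
    using fin by (intro nn_integral_cong) (simp add: points_integral_eq_sum F0 S_def)
  also have "\<dots> = ennreal m1"
    using lam m1 by (simp add: intensity_function_on_def)
  finally show "has_bochner_integral M S m1"
    using S0 m1 by (intro has_bochner_integral_nn_integral) auto
  define D where "D \<omega> = (\<Sum>p\<in>distinct_pairs (X \<omega> \<inter> W). F (fst p) * F (snd p))" for \<omega>
  have finD: "finite (distinct_pairs (X \<omega> \<inter> W))" if "\<omega> \<in> space M" for \<omega>
    by (rule finite_subset[of _ "(X \<omega> \<inter> W) \<times> (X \<omega> \<inter> W)"]) (auto simp: distinct_pairs_def fin that)
  have split: "(S \<omega>)\<^sup>2 = (\<Sum>y\<in>X \<omega> \<inter> W. (F y)\<^sup>2) + D \<omega>" if "\<omega> \<in> space M" for \<omega>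
    unfolding S_def D_def using fin[OF that] by (rule sum_square_eq_diagonal_plus_distinct)
  \<comment> \<open>The sum over distinct pairs is measurable as the difference of the two sums over single points.\<close>
  have "(\<lambda>\<omega>. (S \<omega>)\<^sup>2 - (\<Sum>y\<in>X \<omega> \<inter> W. (F y)\<^sup>2)) \<in> borel_measurable M" by measurable
  also have "?this \<longleftrightarrow> D \<in> borel_measurable M"
    using split by (intro measurable_cong) simp
  finally have D_meas[measurable]: "D \<in> borel_measurable M" .
  have D0: "0 \<le> D \<omega>" for \<omega> unfolding D_def by (intro sum_nonneg mult_nonneg_nonneg F0)
  have "(\<integral>\<^sup>+\<omega>. ennreal ((S \<omega>)\<^sup>2) \<partial>M) = (\<integral>\<^sup>+\<omega>. ennreal (\<Sum>y\<in>X \<omega> \<inter> W. (F y)\<^sup>2) + ennreal (D \<omega>) \<partial>M)"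
    using D0 by (intro nn_integral_cong) (simp add: split sum_nonneg)
  also have "\<dots> = (\<integral>\<^sup>+\<omega>. ennreal (\<Sum>y\<in>X \<omega> \<inter> W. (F y)\<^sup>2) \<partial>M) + (\<integral>\<^sup>+\<omega>. ennreal (D \<omega>) \<partial>M)"
    by (intro nn_integral_add) auto
  also have "(\<integral>\<^sup>+\<omega>. ennreal (\<Sum>y\<in>X \<omega> \<inter> W. (F y)\<^sup>2) \<partial>M)
      = (\<integral>\<^sup>+\<omega>. (\<integral>\<^sup>+y. ennreal ((F y)\<^sup>2) \<partial>count_space (X \<omega> \<inter> W)) \<partial>M)"
    using fin by (intro nn_integral_cong) (simp add: points_integral_eq_sum)
  also have "\<dots> = ennreal m2"
    using lam m2 by (simp add: intensity_function_on_def)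
  also have "(\<integral>\<^sup>+\<omega>. ennreal (D \<omega>) \<partial>M)
      = (\<integral>\<^sup>+\<omega>. (\<integral>\<^sup>+p. ennreal (F (fst p) * F (snd p)) \<partial>count_space (distinct_pairs (X \<omega> \<inter> W))) \<partial>M)"
    using finD by (intro nn_integral_cong) (simp add: points_integral_eq_sum F0 D_def)
  also have "\<dots> = ennreal m12"
  proof -
    have "(\<lambda>p::'a \<times> 'a. ennreal (F (fst p) * F (snd p))) \<in> borel_measurable borel"
      unfolding borel_prod[symmetric] by measurable
    then show ?thesis
      using rho m12 unfolding product_density_on_def by simp
  qed
  also have "ennreal m2 + ennreal m12 = ennreal (m2 + m12)" using m2 m12 by simp
  finally show "has_bochner_integral M (\<lambda>\<omega>. (S \<omega>)\<^sup>2) (m2 + m12)"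
    using m2 m12 by (intro has_bochner_integral_nn_integral) auto
qed

section \<open>Mean squared error of an average\<close>

text \<open>Expand the square of the sum of the centred variables: by independence only the diagonal terms have non-zero
  expectation.\<close>

lemma (in prob_space) mse_average_of_indep:
  fixes X :: "nat \<Rightarrow> 'a \<Rightarrow> real"
  assumes indep: "indep_vars (\<lambda>_. borel) X {1..}"
    and m1: "\<And>i. 1 \<le> i \<Longrightarrow> has_bochner_integral M (X i) m1"
    and m2: "\<And>i. 1 \<le> i \<Longrightarrow> has_bochner_integral M (\<lambda>\<omega>. (X i \<omega>)\<^sup>2) m2"
    and n: "1 \<le> n"
  shows "mse M (\<lambda>\<omega>. 1 / real n * (\<Sum>i\<in>{1..n}. X i \<omega>)) \<theta> = (m2 - m1\<^sup>2) / real n + (m1 - \<theta>)\<^sup>2"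
proof -
  define Y where "Y i \<omega> = X i \<omega> - m1" for i \<omega>
  have pair: "has_bochner_integral M (\<lambda>\<omega>. Y i \<omega> * Y j \<omega>) (if i = j then m2 - m1\<^sup>2 else 0)"
    if ij: "1 \<le> i" "1 \<le> j" for i j
  proof (cases "i = j")
    case True
    have "has_bochner_integral M (\<lambda>\<omega>. (X i \<omega>)\<^sup>2 - 2 * m1 * X i \<omega> + m1\<^sup>2) (m2 - 2 * m1 * m1 + m1\<^sup>2)"
      by (intro has_bochner_integral_add has_bochner_integral_diff has_bochner_integral_mult_right m1 m2 ij)
         (simp add: has_bochner_integral_iff prob_space)
    also have "(\<lambda>\<omega>. (X i \<omega>)\<^sup>2 - 2 * m1 * X i \<omega> + m1\<^sup>2) = (\<lambda>\<omega>. Y i \<omega> * Y j \<omega>)"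
      by (auto simp: Y_def True power2_eq_square algebra_simps)
    also have "m2 - 2 * m1 * m1 + m1\<^sup>2 = m2 - m1\<^sup>2" by (simp add: power2_eq_square)
    finally show ?thesis using True by simp
  next
    case False
    have ind: "indep_var borel (X i) borel (X j)"
      \<comment> \<open>A one-element sum is a way to extract pairwise independence from joint independence.\<close>
      using indep_vars_sum[of "{j}" i X] indep_vars_subset[OF indep, of "{i, j}"] ij False by simp
    have int: "integrable M (X i)" "integrable M (X j)" "expectation (X i) = m1" "expectation (X j) = m1"
      using m1 ij by (auto simp: has_bochner_integral_iff)
    have "has_bochner_integral M (\<lambda>\<omega>. X i \<omega> * X j \<omega>) (m1 * m1)"
      using indep_var_lebesgue_integral[OF ind int(1,2)] indep_var_integrable[OF ind int(1,2)] int
      by (simp add: has_bochner_integral_iff)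
    then have "has_bochner_integral M (\<lambda>\<omega>. X i \<omega> * X j \<omega> - m1 * X i \<omega> - m1 * X j \<omega> + m1 * m1)
        (m1 * m1 - m1 * m1 - m1 * m1 + m1 * m1)"
      by (intro has_bochner_integral_add has_bochner_integral_diff has_bochner_integral_mult_right m1 ij)
         (simp_all add: has_bochner_integral_iff prob_space)
    also have "(\<lambda>\<omega>. X i \<omega> * X j \<omega> - m1 * X i \<omega> - m1 * X j \<omega> + m1 * m1) = (\<lambda>\<omega>. Y i \<omega> * Y j \<omega>)"
      by (auto simp: Y_def algebra_simps)
    finally show ?thesis using False by simp
  qed
  have Y1: "has_bochner_integral M (\<lambda>\<omega>. \<Sum>i\<in>{1..n}. Y i \<omega>) (\<Sum>i\<in>{1..n}. m1 - m1)"
    unfolding Y_def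
    by (intro has_bochner_integral_sum has_bochner_integral_diff m1)
       (auto simp: has_bochner_integral_iff prob_space)
  have Y2: "has_bochner_integral M (\<lambda>\<omega>. \<Sum>i\<in>{1..n}. \<Sum>j\<in>{1..n}. Y i \<omega> * Y j \<omega>)
     (\<Sum>i\<in>{1..n}. \<Sum>j\<in>{1..n}. if i = j then m2 - m1\<^sup>2 else 0)"
    by (intro has_bochner_integral_sum pair) auto
  have avg: "(1 / real n * (\<Sum>i\<in>{1..n}. X i \<omega>) - \<theta>)\<^sup>2
      = 1 / (real n)\<^sup>2 * (\<Sum>i\<in>{1..n}. \<Sum>j\<in>{1..n}. Y i \<omega> * Y j \<omega>)
        + 2 * (m1 - \<theta>) / real n * (\<Sum>i\<in>{1..n}. Y i \<omega>) + (m1 - \<theta>)\<^sup>2" for \<omega>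
  proof -
    have "1 / real n * (\<Sum>i\<in>{1..n}. X i \<omega>) - \<theta> = (\<Sum>i\<in>{1..n}. Y i \<omega>) / real n + (m1 - \<theta>)"
      using n by (simp add: Y_def sum_subtractf field_simps)
    then have "(1 / real n * (\<Sum>i\<in>{1..n}. X i \<omega>) - \<theta>)\<^sup>2
      = (\<Sum>i\<in>{1..n}. Y i \<omega>)\<^sup>2 / (real n)\<^sup>2 + 2 * (m1 - \<theta>) / real n * (\<Sum>i\<in>{1..n}. Y i \<omega>) + (m1 - \<theta>)\<^sup>2"
      by (simp only: power2_sum power_divide times_divide_eq_left times_divide_eq_right mult_ac)
    then show ?thesis by (simp add: power2_eq_square sum_product)
  qed
  have "has_bochner_integral M (\<lambda>\<omega>. (1 / real n * (\<Sum>i\<in>{1..n}. X i \<omega>) - \<theta>)\<^sup>2)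
     (1 / (real n)\<^sup>2 * (\<Sum>i\<in>{1..n}. \<Sum>j\<in>{1..n}. if i = j then m2 - m1\<^sup>2 else 0)
        + 2 * (m1 - \<theta>) / real n * (\<Sum>i\<in>{1..n}. m1 - m1) + (m1 - \<theta>)\<^sup>2)"
    unfolding avg
    by (intro has_bochner_integral_add has_bochner_integral_mult_right Y1 Y2)
       (auto simp: has_bochner_integral_iff prob_space)
  then show ?thesis
    unfolding mse_def by (auto dest!: has_bochner_integral_integral_eq simp: power2_eq_square)
qed

section \<open>Functions with continuous partial derivatives\<close>

lemma partials_append: "partials (bs @ bs') f = partials bs (partials bs' f)"
  by (induction bs) auto

lemma basis_tuples_0: "basis_tuples 0 = {[]}"
  by (auto simp: basis_tuples_def)

lemma basis_tuples_Suc: "basis_tuples (Suc r) = (\<lambda>(b, bs). b # bs) ` (Basis \<times> basis_tuples r)"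
  by (auto simp: basis_tuples_def length_Suc_conv image_iff)

lemma basis_tuples_snoc: "bs @ [b] \<in> basis_tuples (Suc r) \<longleftrightarrow> b \<in> Basis \<and> bs \<in> basis_tuples r"
  by (auto simp: basis_tuples_def)

lemma basis_tuples_snocE:
  assumes "bs \<in> basis_tuples (Suc r)"
  obtains b bs' where "bs = bs' @ [b]" "b \<in> Basis" "bs' \<in> basis_tuples r"
  using assms by (cases bs rule: rev_cases) (auto simp: basis_tuples_def)

lemma diff_form_0: "diff_form 0 f x u = f x"
  by (simp add: diff_form_def basis_tuples_0)

lemma diff_form_Suc:
  "diff_form (Suc r) f x u =
     (\<Sum>b\<in>Basis. \<Sum>bs\<in>basis_tuples r. (u \<bullet> b) * prod_list (map (\<lambda>b. u \<bullet> b) bs) * partials (b # bs) f x)"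
  unfolding diff_form_def basis_tuples_Suc
  by (subst sum.reindex) (auto simp: inj_on_def sum.cartesian_product case_prod_beta)

lemma prod_list_scaleR_inner:
  "prod_list (map (\<lambda>b. (s *\<^sub>R u) \<bullet> b) bs) = s ^ length bs * prod_list (map (\<lambda>b. u \<bullet> b) bs)"
  by (induction bs) auto

lemma diff_form_scaleR: "diff_form r f x (s *\<^sub>R u) = s ^ r * diff_form r f x u"
  unfolding diff_form_def sum_distrib_left
proof (rule sum.cong[OF refl])
  fix bs :: "'a list" assume "bs \<in> basis_tuples r"
  then have "length bs = r" by (simp add: basis_tuples_def)
  then show "prod_list (map ((\<bullet>) (s *\<^sub>R u)) bs) * partials bs f x
      = s ^ r * (prod_list (map ((\<bullet>) u) bs) * partials bs f x)"
    using prod_list_scaleR_inner[of s u bs] by (simp only: mult.assoc)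
qed

lemma continuous_on_prod_list_inner:
  "continuous_on S (\<lambda>z. prod_list (map (\<lambda>b. f z \<bullet> b) bs))" if "continuous_on S f"
  using that by (induction bs) (auto intro!: continuous_intros)

lemma continuous_on_diff_form:
  assumes cont: "\<And>bs. bs \<in> basis_tuples r \<Longrightarrow> continuous_on W (partials bs f)"
    and p: "continuous_on S p" "p ` S \<subseteq> W" and q: "continuous_on S q"
  shows "continuous_on S (\<lambda>z. diff_form r f (p z) (q z))"
  unfolding diff_form_def
  by (intro continuous_on_sum continuous_on_mult continuous_on_prod_list_inner[OF q]
      continuous_on_compose2[OF cont p]) 

text \<open>Walk from \<open>x\<close> to \<open>x + v\<close> one coordinate direction at a time and apply the mean value inequality to each leg. The
  induction is over the set \<open>B\<close> of directions already used; all intermediate points stay in the ball.\<close>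

lemma partial_derivs_increment:
  fixes f :: "'a::euclidean_space \<Rightarrow> real"
  assumes d: "\<And>b z. b \<in> Basis \<Longrightarrow> z \<in> ball x \<delta> \<Longrightarrow> (\<lambda>t. f (z + t *\<^sub>R b)) field_differentiable (at 0)"
    and close: "\<And>b z. b \<in> Basis \<Longrightarrow> z \<in> ball x \<delta> \<Longrightarrow> \<bar>partial_deriv b f z - partial_deriv b f x\<bar> \<le> e"
    and B: "finite B" "B \<subseteq> Basis" and v: "norm v * card B < \<delta>"
  shows "\<bar>f (x + (\<Sum>b\<in>B. (v \<bullet> b) *\<^sub>R b)) - f x - (\<Sum>b\<in>B. (v \<bullet> b) * partial_deriv b f x)\<bar> \<le> e * norm v * card B"
  using B v
proof (induction B)
  case empty
  then show ?case by simp
next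
  case (insert b B)
  define y where "y = x + (\<Sum>b\<in>B. (v \<bullet> b) *\<^sub>R b)"
  define s where "s = v \<bullet> b"
  have card: "real (card (insert b B)) = card B + 1" using insert by simp
  have vB: "norm v * card B < \<delta>"
    using insert.prems card by (simp add: algebra_simps) (smt (verit) norm_ge_zero)
  have s: "\<bar>s\<bar> \<le> norm v" using Basis_le_norm[of b v] insert by (simp add: s_def)
  have "norm (\<Sum>b\<in>B. (v \<bullet> b) *\<^sub>R b) \<le> (\<Sum>b\<in>B. norm v)"
    using insert.prems by (intro sum_norm_le) (auto simp: Basis_le_norm)
  then have "norm (y - x) \<le> (\<Sum>b\<in>B. norm v)" by (simp add: y_def)
  then have yx: "norm (y - x) \<le> norm v * card B" by (simp add: mult.commute)
  have in_ball: "y + t *\<^sub>R b \<in> ball x \<delta>" if "\<bar>t\<bar> \<le> \<bar>s\<bar>" for t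
  proof -
    have "norm (y + t *\<^sub>R b - x) \<le> norm (y - x) + norm (t *\<^sub>R b)"
      using norm_triangle_ineq[of "y - x" "t *\<^sub>R b"] by (simp add: algebra_simps)
    also have "\<dots> \<le> norm v * card B + norm v"
      using yx that s insert.prems by auto
    also have "\<dots> < \<delta>" using insert.prems card by (simp add: algebra_simps)
    finally show ?thesis by (simp add: dist_norm norm_minus_commute)
  qed
  have bB: "b \<in> Basis" using insert by simp
  have der: "((\<lambda>t. f (y + t *\<^sub>R b)) has_field_derivative partial_deriv b f (y + t *\<^sub>R b)) (at t)"
    if "\<bar>t\<bar> \<le> \<bar>s\<bar>" for t
  proof -
    have "((\<lambda>r. f ((y + t *\<^sub>R b) + r *\<^sub>R b)) has_field_derivative partial_deriv b f (y + t *\<^sub>R b)) (at 0)"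
      unfolding partial_deriv_def
      using d[OF bB in_ball[OF that]] by (rule field_differentiable_derivI)
    then show ?thesis
      using DERIV_shift[of "\<lambda>r. f (y + r *\<^sub>R b)" _ 0 t] by (simp add: algebra_simps)
  qed
  define D where "D = partial_deriv b f x"
  have "norm ((f (y + s *\<^sub>R b) - s * D) - (f (y + 0 *\<^sub>R b) - 0 * D)) \<le> e * norm (s - 0)"
  proof (rule field_differentiable_bound[where f' = "\<lambda>t. partial_deriv b f (y + t *\<^sub>R b) - D" and S = "closed_segment 0 s"])
    fix t assume "t \<in> closed_segment 0 s"
    then have t: "\<bar>t\<bar> \<le> \<bar>s\<bar>" by (auto simp: closed_segment_eq_real_ivl split: if_splits)
    show "((\<lambda>t. f (y + t *\<^sub>R b) - t * D) has_field_derivative partial_deriv b f (y + t *\<^sub>R b) - D)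
        (at t within closed_segment 0 s)"
      by (rule DERIV_subset[where s=UNIV]) (auto intro!: derivative_eq_intros der[OF t])
    show "norm (partial_deriv b f (y + t *\<^sub>R b) - D) \<le> e"
      using close[OF bB in_ball[OF t]] by (simp add: D_def)
  qed auto
  moreover have "0 \<le> e" using close[OF bB, of y] in_ball[of 0] by auto
  ultimately have step: "\<bar>f (y + s *\<^sub>R b) - f y - s * D\<bar> \<le> e * norm v"
    using mult_left_mono[OF s, of e] by (simp add: algebra_simps)
  have "\<bar>f y - f x - (\<Sum>b\<in>B. (v \<bullet> b) * partial_deriv b f x)\<bar> \<le> e * norm v * card B"
    unfolding y_def using insert vB by (intro insert.IH) auto
  moreover have "x + (\<Sum>b\<in>insert b B. (v \<bullet> b) *\<^sub>R b) = y + s *\<^sub>R b"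
    using insert by (simp add: y_def s_def algebra_simps)
  moreover have "(\<Sum>b\<in>insert b B. (v \<bullet> b) * partial_deriv b f x) = s * D + (\<Sum>b\<in>B. (v \<bullet> b) * partial_deriv b f x)"
    using insert by (simp add: s_def D_def)
  ultimately show ?case using step card by (simp add: algebra_simps)
qed

lemma has_derivative_of_continuous_partials:
  fixes f :: "'a::euclidean_space \<Rightarrow> real"
  assumes W: "open W" "x \<in> W"
    and d: "\<And>b z. b \<in> Basis \<Longrightarrow> z \<in> W \<Longrightarrow> (\<lambda>t. f (z + t *\<^sub>R b)) field_differentiable (at 0)"
    and c: "\<And>b. b \<in> Basis \<Longrightarrow> continuous_on W (partial_deriv b f)"
  shows "(f has_derivative (\<lambda>v. \<Sum>b\<in>Basis. (v \<bullet> b) * partial_deriv b f x)) (at x)"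
  unfolding has_derivative_at_alt
proof (intro conjI allI impI)
  show "bounded_linear (\<lambda>v. \<Sum>b\<in>Basis. (v \<bullet> b) * partial_deriv b f x)"
    by (intro bounded_linear_sum bounded_linear_mult_left[THEN bounded_linear_compose] bounded_linear_inner_left)
  fix e :: real assume e: "0 < e"
  define e' where "e' = e / DIM('a)"
  have e': "0 < e'" using e by (simp add: e'_def)
  have "\<exists>\<delta>>0. ball x \<delta> \<subseteq> W \<and> (\<forall>z\<in>ball x \<delta>. \<bar>partial_deriv b f z - partial_deriv b f x\<bar> \<le> e')" if b: "b \<in> Basis" for b
  proof -
    have "continuous (at x) (partial_deriv b f)"
      using c[OF b] W by (simp add: continuous_on_eq_continuous_at)
    then obtain d1 where d1: "0 < d1" "\<And>z. dist z x < d1 \<Longrightarrow> dist (partial_deriv b f z) (partial_deriv b f x) < e'"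
      using e' unfolding continuous_at_eps_delta by metis
    obtain d2 where d2: "0 < d2" "ball x d2 \<subseteq> W"
      using W by (auto simp: open_contains_ball)
    show ?thesis
    proof (intro exI[of _ "min d1 d2"] conjI ballI)
      fix z assume "z \<in> ball x (min d1 d2)"
      then show "\<bar>partial_deriv b f z - partial_deriv b f x\<bar> \<le> e'"
        using d1(2)[of z] by (simp add: dist_commute dist_real_def)
    qed (use d1 d2 in auto)
  qed
  then obtain \<delta> where \<delta>: "\<And>b. b \<in> Basis \<Longrightarrow> 0 < \<delta> b" "\<And>b. b \<in> Basis \<Longrightarrow> ball x (\<delta> b) \<subseteq> W"
    "\<And>b z. b \<in> Basis \<Longrightarrow> z \<in> ball x (\<delta> b) \<Longrightarrow> \<bar>partial_deriv b f z - partial_deriv b f x\<bar> \<le> e'"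
    by metis
  define m where "m = Min (\<delta> ` Basis)"
  have m: "0 < m" "\<And>b. b \<in> Basis \<Longrightarrow> m \<le> \<delta> b" using \<delta> by (auto simp: m_def)
  have sub: "ball x m \<subseteq> ball x (\<delta> b)" if "b \<in> Basis" for b using m(2)[OF that] by auto
  show "\<exists>d>0. \<forall>y. norm (y - x) < d \<longrightarrow>
      norm (f y - f x - (\<Sum>b\<in>Basis. ((y - x) \<bullet> b) * partial_deriv b f x)) \<le> e * norm (y - x)"
  proof (intro exI[of _ "m / DIM('a)"] conjI allI impI)
    fix y assume y: "norm (y - x) < m / DIM('a)"
    have "\<bar>f (x + (\<Sum>b\<in>Basis. ((y - x) \<bullet> b) *\<^sub>R b)) - f x - (\<Sum>b\<in>Basis. ((y - x) \<bullet> b) * partial_deriv b f x)\<bar>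
        \<le> e' * norm (y - x) * card (Basis :: 'a set)"
    proof (rule partial_derivs_increment)
      fix b z :: 'a assume b: "b \<in> Basis" and z: "z \<in> ball x m"
      show "(\<lambda>t. f (z + t *\<^sub>R b)) field_differentiable at 0"
        using d[OF b, of z] z sub[OF b] \<delta>(2)[OF b] by blast
      show "\<bar>partial_deriv b f z - partial_deriv b f x\<bar> \<le> e'"
        using \<delta>(3)[OF b, of z] z sub[OF b] by auto
    qed (use y in \<open>auto simp: field_simps\<close>)
    then show "norm (f y - f x - (\<Sum>b\<in>Basis. ((y - x) \<bullet> b) * partial_deriv b f x)) \<le> e * norm (y - x)"
      by (simp add: euclidean_representation e'_def)
  qed (use m in auto)
qed

lemma times_cont_differentiable_on_0: "times_cont_differentiable_on 0 f W \<longleftrightarrow> continuous_on W f"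
  by (simp add: times_cont_differentiable_on_def basis_tuples_0)

text \<open>An index tuple is a list in which the last entry is differentiated first. Splitting off that entry makes the class
  of \<open>k\<close> times continuously differentiable functions recursive in \<open>k\<close>, so that its closure properties follow by induction.\<close>

lemma times_cont_differentiable_on_Suc:
  "times_cont_differentiable_on (Suc k) f W \<longleftrightarrow> continuous_on W f \<and>
     (\<forall>b\<in>Basis. (\<forall>x\<in>W. (\<lambda>t. f (x + t *\<^sub>R b)) field_differentiable (at 0)) \<and>
        times_cont_differentiable_on k (partial_deriv b f) W)" (is "?L \<longleftrightarrow> ?R")
proof
  assume L: ?L
  note L1 = L[unfolded times_cont_differentiable_on_def, THEN conjunct1, rule_format]
    and L2 = L[unfolded times_cont_differentiable_on_def, THEN conjunct2, rule_format]
  have snoc: "partials bs (partial_deriv b f) = partials (bs @ [b]) f" for bs b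
    by (simp add: partials_append)
  show ?R
  proof (intro conjI ballI)
    show "continuous_on W f" using L2[of 0 "[]"] by (simp add: basis_tuples_0)
    fix b x :: 'a assume b: "b \<in> Basis" and "x \<in> W"
    then show "(\<lambda>t. f (x + t *\<^sub>R b)) field_differentiable at 0"
      using L1[of 0 "[]" b x] by (simp add: basis_tuples_0)
  next
    fix b :: 'a assume b: "b \<in> Basis"
    show "times_cont_differentiable_on k (partial_deriv b f) W"
      unfolding times_cont_differentiable_on_def snoc
      using b by (intro conjI allI impI ballI L1[of "Suc _"] L2[of "Suc _"]) (auto simp: basis_tuples_snoc)
  qed
next
  assume R: ?R
  then have R1: "\<And>b. b \<in> Basis \<Longrightarrow> times_cont_differentiable_on k (partial_deriv b f) W" by auto
  show ?L
    unfolding times_cont_differentiable_on_def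
  proof (intro conjI allI impI ballI)
    fix r and bs :: "'a list" and b x :: 'a assume r: "r < Suc k" and bs: "bs \<in> basis_tuples r" and bx: "b \<in> Basis" "x \<in> W"
    show "(\<lambda>t. partials bs f (x + t *\<^sub>R b)) field_differentiable at 0"
    proof (cases r)
      case 0
      then show ?thesis using bs bx R by (simp add: basis_tuples_0)
    next
      case (Suc r')
      with bs obtain b' bs' where "bs = bs' @ [b']" "b' \<in> Basis" "bs' \<in> basis_tuples r'"
        by (auto elim: basis_tuples_snocE)
      then show ?thesis
        using R1[of b'] r bx Suc unfolding times_cont_differentiable_on_def by (auto simp: partials_append)
    qed
  next
    fix r and bs :: "'a list" assume r: "r \<le> Suc k" and bs: "bs \<in> basis_tuples r"
    show "continuous_on W (partials bs f)"
    proof (cases r)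
      case 0
      then show ?thesis using bs R by (simp add: basis_tuples_0)
    next
      case (Suc r')
      with bs obtain b' bs' where "bs = bs' @ [b']" "b' \<in> Basis" "bs' \<in> basis_tuples r'"
        by (auto elim: basis_tuples_snocE)
      then show ?thesis
        using R1[of b'] r Suc unfolding times_cont_differentiable_on_def by (auto simp: partials_append)
    qed
  qed
qed

lemma times_cont_differentiable_on_mono:
  "times_cont_differentiable_on k f W \<Longrightarrow> j \<le> k \<Longrightarrow> times_cont_differentiable_on j f W"
  unfolding times_cont_differentiable_on_def by (meson le_trans less_le_trans)

lemma eventually_line_in_open:
  fixes x :: "'a::real_normed_vector"
  assumes "open W" "x \<in> W"
  shows "eventually (\<lambda>t. x + t *\<^sub>R b \<in> W) (nhds (0::real))"
proof -
  have "((\<lambda>t. x + t *\<^sub>R b) \<longlongrightarrow> x + 0 *\<^sub>R b) (nhds (0::real))"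
    by (intro tendsto_intros filterlim_ident)
  with assms show ?thesis by (auto dest: topological_tendstoD)
qed

lemma partial_deriv_cong:
  assumes "open W" "x \<in> W" "\<And>x. x \<in> W \<Longrightarrow> f x = g x"
  shows "partial_deriv b f x = partial_deriv b g x"
  unfolding partial_deriv_def
proof (rule deriv_cong_ev)
  show "eventually (\<lambda>t. f (x + t *\<^sub>R b) = g (x + t *\<^sub>R b)) (nhds 0)"
    by (rule eventually_mono[OF eventually_line_in_open[OF assms(1,2)]]) (rule assms(3))
qed simp

lemma times_cont_differentiable_on_cong:
  assumes "open W" "\<And>x. x \<in> W \<Longrightarrow> f x = g x" "times_cont_differentiable_on k f W"
  shows "times_cont_differentiable_on k g W"
  using assms(2,3)
proof (induction k arbitrary: f g)
  case 0
  then show ?case by (simp add: times_cont_differentiable_on_0 cong: continuous_on_cong)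
next
  case (Suc k)
  have "(\<lambda>t. g (x + t *\<^sub>R b)) field_differentiable at 0"
    if f: "(\<lambda>t. f (x + t *\<^sub>R b)) field_differentiable at 0" and x: "x \<in> W" for x b
  proof -
    have ev: "eventually (\<lambda>t. g (x + t *\<^sub>R b) = f (x + t *\<^sub>R b)) (nhds (0::real))"
      by (rule eventually_mono[OF eventually_line_in_open[OF assms(1) x, of b]]) (simp add: Suc.prems(1))
    show ?thesis
      using f DERIV_cong_ev[OF refl ev refl] unfolding field_differentiable_def by auto
  qed
  moreover have "times_cont_differentiable_on k (partial_deriv b g) W" if "b \<in> Basis" for b
  proof (rule Suc.IH[of "partial_deriv b f"])
    show "partial_deriv b f x = partial_deriv b g x" if "x \<in> W" for x
      using assms(1) that Suc.prems(1) by (rule partial_deriv_cong)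
  qed (use Suc.prems that in \<open>auto simp: times_cont_differentiable_on_Suc\<close>)
  ultimately show ?case
    using Suc.prems by (auto simp: times_cont_differentiable_on_Suc cong: continuous_on_cong)
qed

lemma times_cont_differentiable_on_SucI:
  assumes "open W" "continuous_on W f"
    and "\<And>b x. b \<in> Basis \<Longrightarrow> x \<in> W \<Longrightarrow> ((\<lambda>t. f (x + t *\<^sub>R b)) has_field_derivative f' b x) (at 0)"
    and "\<And>b. b \<in> Basis \<Longrightarrow> times_cont_differentiable_on k (f' b) W"
  shows "times_cont_differentiable_on (Suc k) f W"
proof -
  have "times_cont_differentiable_on k (partial_deriv b f) W" if b: "b \<in> Basis" for b
    using assms(3)[OF b] unfolding partial_deriv_def
    by (intro times_cont_differentiable_on_cong[OF assms(1) _ assms(4)[OF b]])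
       (auto intro: DERIV_imp_deriv[symmetric])
  then show ?thesis
    using assms unfolding times_cont_differentiable_on_Suc field_differentiable_def by blast
qed

lemma times_cont_differentiable_on_SucD:
  assumes "times_cont_differentiable_on (Suc k) f W"
  shows "continuous_on W f"
    and "b \<in> Basis \<Longrightarrow> x \<in> W \<Longrightarrow>
          ((\<lambda>t. f (x + t *\<^sub>R b)) has_field_derivative partial_deriv b f x) (at 0)"
    and "b \<in> Basis \<Longrightarrow> times_cont_differentiable_on k (partial_deriv b f) W"
  using assms unfolding times_cont_differentiable_on_Suc
  by (auto simp: partial_deriv_def field_differentiable_derivI)

lemma times_cont_differentiable_on_const:
  "open W \<Longrightarrow> times_cont_differentiable_on k (\<lambda>_. a) W"
proof (induction k arbitrary: a)
  case (Suc k)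
  then show ?case
    by (intro times_cont_differentiable_on_SucI[where f' = "\<lambda>_ _. 0"]) auto
qed (simp add: times_cont_differentiable_on_0)

lemma times_cont_differentiable_on_add:
  assumes "open W" "times_cont_differentiable_on k f W" "times_cont_differentiable_on k g W"
  shows "times_cont_differentiable_on k (\<lambda>x. f x + g x) W"
  using assms(2,3)
proof (induction k arbitrary: f g)
  case 0
  then show ?case by (simp add: times_cont_differentiable_on_0 continuous_on_add)
next
  case (Suc k)
  note f = times_cont_differentiable_on_SucD[OF Suc.prems(1)]
    and g = times_cont_differentiable_on_SucD[OF Suc.prems(2)]
  show ?case
    using f g
    by (intro times_cont_differentiable_on_SucI[OF assms(1), where f' = "\<lambda>b x. partial_deriv b f x + partial_deriv b g x"]
        continuous_on_add DERIV_add Suc.IH) auto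
qed

lemma times_cont_differentiable_on_mult:
  assumes "open W" "times_cont_differentiable_on k f W" "times_cont_differentiable_on k g W"
  shows "times_cont_differentiable_on k (\<lambda>x. f x * g x) W"
  using assms(2,3)
proof (induction k arbitrary: f g)
  case 0
  then show ?case by (simp add: times_cont_differentiable_on_0 continuous_on_mult)
next
  case (Suc k)
  note f = times_cont_differentiable_on_SucD[OF Suc.prems(1)]
    and g = times_cont_differentiable_on_SucD[OF Suc.prems(2)]
  note fg = Suc.prems[THEN times_cont_differentiable_on_mono[of _ _ _ k]]
  show ?case
  proof (rule times_cont_differentiable_on_SucI[OF assms(1)])
    show "continuous_on W (\<lambda>x. f x * g x)" by (intro continuous_on_mult f g)
    fix b :: 'a assume b: "b \<in> Basis"
    show "times_cont_differentiable_on k (\<lambda>x. partial_deriv b f x * g x + partial_deriv b g x * f x) W"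
      using f(3)[OF b] g(3)[OF b] fg
      by (intro times_cont_differentiable_on_add[OF assms(1)] Suc.IH) auto
    fix x assume x: "x \<in> W"
    show "((\<lambda>t. f (x + t *\<^sub>R b) * g (x + t *\<^sub>R b)) has_field_derivative
        partial_deriv b f x * g x + partial_deriv b g x * f x) (at 0)"
      using DERIV_mult[OF f(2)[OF b x] g(2)[OF b x]] by simp
  qed
qed

text \<open>All exponents are treated at once, since differentiation turns the exponent \<open>a\<close> into \<open>a - 1\<close>.\<close>

lemma times_cont_differentiable_on_powr:
  assumes "open W" "times_cont_differentiable_on k f W" "\<And>x. x \<in> W \<Longrightarrow> 0 < f x"
  shows "times_cont_differentiable_on k (\<lambda>x. f x powr a) W"
  using assms(2)
proof (induction k arbitrary: a)
  case 0
  then show ?case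
    using assms(3) unfolding times_cont_differentiable_on_0
    by (intro continuous_on_powr continuous_on_const) force+
next
  case (Suc k)
  note f = times_cont_differentiable_on_SucD[OF Suc.prems(1)]
  note fk = Suc.prems[THEN times_cont_differentiable_on_mono[of _ _ _ k]]
  show ?case
  proof (rule times_cont_differentiable_on_SucI[OF assms(1)])
    show "continuous_on W (\<lambda>x. f x powr a)"
      using assms(3) by (intro continuous_on_powr f(1) continuous_on_const) force
    fix b :: 'a assume b: "b \<in> Basis"
    show "times_cont_differentiable_on k (\<lambda>x. (a * f x powr (a - 1)) * partial_deriv b f x) W"
      by (intro times_cont_differentiable_on_mult times_cont_differentiable_on_const assms(1) Suc.IH fk f(3)[OF b]) simp
    fix x assume x: "x \<in> W"
    show "((\<lambda>t. f (x + t *\<^sub>R b) powr a) has_field_derivative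
        (a * f x powr (a - 1)) * partial_deriv b f x) (at 0)"
      using DERIV_chain2[OF has_real_derivative_powr[of "f (x + 0 *\<^sub>R b)" a] f(2)[OF b x]] assms(3)[OF x] by simp
  qed
qed

lemma times_cont_differentiable_on_weight:
  assumes "open W" "times_cont_differentiable_on k lam W" "\<And>x. x \<in> W \<Longrightarrow> 0 < lam x"
  shows "times_cont_differentiable_on k (weight lam x0) W"
proof (rule times_cont_differentiable_on_cong[OF assms(1)])
  show "times_cont_differentiable_on k (\<lambda>x. lam x powr (1/2) * (1 / sqrt (lam x0))) W"
    by (intro times_cont_differentiable_on_mult times_cont_differentiable_on_const
        times_cont_differentiable_on_powr assms)
  fix x assume "x \<in> W"
  with assms(3)[of x] show "lam x powr (1/2) * (1 / sqrt (lam x0)) = weight lam x0 x"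
    by (simp add: weight_def powr_half_sqrt real_sqrt_divide)
qed

text \<open>The partial derivatives of \<open>f\<close> of order \<open>r\<close> are continuously differentiable, hence totally differentiable, so the chain
  rule applies to them along the line \<open>s \<mapsto> x + s u\<close>.\<close>

lemma DERIV_diff_form_line:
  fixes f :: "'a::euclidean_space \<Rightarrow> real"
  assumes W: "open W" "x + t *\<^sub>R u \<in> W" and f: "times_cont_differentiable_on k f W" and r: "r < k"
  shows "((\<lambda>s. diff_form r f (x + s *\<^sub>R u) u) has_field_derivative
           diff_form (Suc r) f (x + t *\<^sub>R u) u) (at t)"
proof -
  have line: "((\<lambda>s. partials bs f (x + s *\<^sub>R u)) has_field_derivative
       (\<Sum>b\<in>Basis. (u \<bullet> b) * partials (b # bs) f (x + t *\<^sub>R u))) (at t)" if bs: "bs \<in> basis_tuples r" for bs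
  proof -
    have "(partials bs f has_derivative (\<lambda>v. \<Sum>b\<in>Basis. (v \<bullet> b) * partial_deriv b (partials bs f) (x + t *\<^sub>R u)))
        (at (x + t *\<^sub>R u))"
    proof (rule has_derivative_of_continuous_partials[OF W])
      fix b :: 'a assume b: "b \<in> Basis"
      have "b # bs \<in> basis_tuples (Suc r)" using b bs by (auto simp: basis_tuples_def)
      then show "continuous_on W (partial_deriv b (partials bs f))"
        using f r unfolding times_cont_differentiable_on_def by (metis Suc_leI partials.simps(2))
    qed (use f r bs in \<open>auto simp: times_cont_differentiable_on_def\<close>)
    moreover have "((\<lambda>s. x + s *\<^sub>R u) has_derivative (\<lambda>s. s *\<^sub>R u)) (at t)"
      by (auto intro!: derivative_eq_intros)
    ultimately have "((\<lambda>s. partials bs f (x + s *\<^sub>R u)) has_derivative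
        (\<lambda>s. \<Sum>b\<in>Basis. ((s *\<^sub>R u) \<bullet> b) * partial_deriv b (partials bs f) (x + t *\<^sub>R u))) (at t)"
      by (rule has_derivative_compose[rotated])
    then show ?thesis
      unfolding has_field_derivative_def
      by (rule has_derivative_eq_rhs) (auto simp: sum_distrib_left sum_distrib_right mult_ac)
  qed
  have "((\<lambda>s. diff_form r f (x + s *\<^sub>R u) u) has_field_derivative
      (\<Sum>bs\<in>basis_tuples r. prod_list (map (\<lambda>b. u \<bullet> b) bs) *
         (\<Sum>b\<in>Basis. (u \<bullet> b) * partials (b # bs) f (x + t *\<^sub>R u)))) (at t)"
    unfolding diff_form_def by (intro DERIV_sum DERIV_cmult line)
  also have "(\<Sum>bs\<in>basis_tuples r. prod_list (map (\<lambda>b. u \<bullet> b) bs) *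
         (\<Sum>b\<in>Basis. (u \<bullet> b) * partials (b # bs) f (x + t *\<^sub>R u))) = diff_form (Suc r) f (x + t *\<^sub>R u) u"
    unfolding diff_form_Suc by (subst sum.swap) (simp add: sum_distrib_left mult_ac)
  finally show ?thesis .
qed

section \<open>The kernel profile and its derivatives\<close>

text \<open>At the origin the difference quotient is dominated by \<open>|x| powr (a - 1)\<close>, which tends to zero since \<open>a > 1\<close>.\<close>

lemma DERIV_pos_part_powr:
  fixes x :: real
  assumes a: "1 < a"
  shows "((\<lambda>x. max 0 x powr a) has_real_derivative a * max 0 x powr (a - 1)) (at x)"
proof -
  consider "x < 0" | "x = 0" | "0 < x" by linarith
  then show ?thesis
  proof cases
    case 1
    have "eventually (\<lambda>y. y \<in> {..<0}) (nhds x)" using 1 by (intro eventually_nhds_in_open) auto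
    then have ev: "eventually (\<lambda>y. max 0 y powr a = 0) (nhds x)" by eventually_elim (auto simp: max_def)
    show ?thesis using DERIV_cong_ev[OF refl ev refl] 1 by (auto simp: max_def)
  next
    case 3
    have "eventually (\<lambda>y. y \<in> {0<..}) (nhds x)" using 3 by (intro eventually_nhds_in_open) auto
    then have ev: "eventually (\<lambda>y. max 0 y powr a = y powr a) (nhds x)" by eventually_elim (auto simp: max_def)
    show ?thesis using DERIV_cong_ev[OF refl ev refl] has_real_derivative_powr[OF 3, of a] 3 by (auto simp: max_def)
  next
    case 2
    have "((\<lambda>y. \<bar>y\<bar> powr (a - 1)) \<longlongrightarrow> \<bar>0\<bar> powr (a - 1)) (at (0::real))"
      using a by (intro tendsto_powr' tendsto_intros) auto
    then have lim: "((\<lambda>y. \<bar>y\<bar> powr (a - 1)) \<longlongrightarrow> 0) (at (0::real))" using a by simp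
    have "((\<lambda>y. max 0 y powr a / y) \<longlongrightarrow> 0) (at (0::real))"
    proof (rule Lim_null_comparison[OF _ lim])
      show "eventually (\<lambda>y. norm (max 0 y powr a / y) \<le> \<bar>y\<bar> powr (a - 1)) (at (0::real))"
        using a by (intro eventuallyI) (auto simp: max_def powr_diff divide_nonneg_neg divide_le_0_iff)
    qed
    then show ?thesis unfolding has_field_derivative_iff 2 using a by simp
  qed
qed

text \<open>\<open>scaled_profile j m a q v\<close> is, for \<open>j < a\<close>, the \<open>j\<close>-th derivative at \<open>v\<close> of \<open>v ^ m * (1 - v\<^sup>2 q)\<^sub>+ powr a\<close>. The recursion is Leibniz'
  rule: differentiation leads to functions of the same kind with \<open>(m - 1, a)\<close> and \<open>(m + 1, a - 1)\<close>. With
  \<open>q = |u|\<^sup>2\<close>, the parameters \<open>m = d + 2\<close>, \<open>a = \<gamma>\<close> give \<open>g\<^sub>u\<close>, and \<open>m = 2 d + 2\<close>, \<open>a = 2 \<gamma>\<close> its counterpart for the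
  squared kernel, both up to normalisation.\<close>

fun scaled_profile :: "nat \<Rightarrow> nat \<Rightarrow> real \<Rightarrow> real \<Rightarrow> real \<Rightarrow> real" where
  "scaled_profile 0 m a q v = v ^ m * max 0 (1 - v\<^sup>2 * q) powr a"
| "scaled_profile (Suc j) m a q v =
     real m * scaled_profile j (m - 1) a q v - 2 * a * q * scaled_profile j (m + 1) (a - 1) q v"

lemma DERIV_scaled_profile:
  "real j + 1 < a \<Longrightarrow> (scaled_profile j m a q has_real_derivative scaled_profile (Suc j) m a q v) (at v)"
proof (induction j arbitrary: m a)
  case 0
  have "((\<lambda>v. v ^ m * max 0 (1 - v\<^sup>2 * q) powr a) has_real_derivative
     (real m * v ^ (m - 1)) * max 0 (1 - v\<^sup>2 * q) powr a
       + (a * max 0 (1 - v\<^sup>2 * q) powr (a - 1) * (- (2 * v * q))) * v ^ m) (at v)"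
    using 0 by (intro DERIV_mult DERIV_chain2[OF DERIV_pos_part_powr])
      (auto intro!: derivative_eq_intros)
  then show ?case
    by (simp add: algebra_simps)
next
  case (Suc j)
  have "((\<lambda>v. real m * scaled_profile j (m - 1) a q v - 2 * a * q * scaled_profile j (m + 1) (a - 1) q v)
     has_real_derivative real m * scaled_profile (Suc j) (m - 1) a q v
        - 2 * a * q * scaled_profile (Suc j) (m + 1) (a - 1) q v) (at v)"
    using Suc.prems by (intro DERIV_diff DERIV_cmult Suc.IH) auto
  then show ?case by simp
qed

lemma continuous_on_scaled_profile:
  assumes "continuous_on S p" "continuous_on S r" "real j < a"
  shows "continuous_on S (\<lambda>z. scaled_profile j m a (p z) (r z))"
  using assms(3)
proof (induction j arbitrary: m a)
  case 0
  then show ?case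
    using assms(1,2) by (auto intro!: continuous_intros continuous_on_powr')
next
  case (Suc j)
  then show ?case
    using assms(1,2) by (auto intro!: continuous_intros)
qed

lemma scaled_profile_eq_0: "1 \<le> v\<^sup>2 * q \<Longrightarrow> scaled_profile j m a q v = 0"
  by (induction j arbitrary: m a) (auto simp: max_def)

lemma beta_kernel_eq_profile:
  "beta_kernel \<gamma> (v *\<^sub>R (u::'a::euclidean_space)) = max 0 (1 - v\<^sup>2 * (u \<bullet> u)) powr \<gamma> / beta_const TYPE('a) \<gamma>"
proof -
  have *: "v * (v * (u \<bullet> u)) = (norm (v *\<^sub>R u))\<^sup>2"
    by (simp only: power2_norm_eq_inner inner_scaleR_left inner_scaleR_right)
  show ?thesis
  proof (cases "norm (v *\<^sub>R u) \<le> 1")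
    case True
    then have "v * (v * (u \<bullet> u)) \<le> 1" unfolding * by (simp add: abs_square_le_1 power_le_one)
    then show ?thesis using True
      by (simp add: beta_kernel_def power2_eq_square mult.assoc max_def)
  next
    case False
    then have "1 < v * (v * (u \<bullet> u))" unfolding * by (intro one_less_power) auto
    then show ?thesis using False
      by (simp add: beta_kernel_def power2_eq_square mult.assoc max_def)
  qed
qed

lemma g_fun_eq_profile:
  "g_fun \<gamma> (u::'a::euclidean_space) v = scaled_profile 0 (DIM('a) + 2) \<gamma> (u \<bullet> u) v / beta_const TYPE('a) \<gamma>"
  by (simp add: g_fun_def beta_kernel_eq_profile)

lemma higher_deriv_g_fun:
  assumes "real j < \<gamma>"
  shows "(deriv ^^ j) (g_fun \<gamma> (u::'a::euclidean_space))
     = (\<lambda>v. scaled_profile j (DIM('a) + 2) \<gamma> (u \<bullet> u) v / beta_const TYPE('a) \<gamma>)"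
  using assms
proof (induction j)
  case 0
  then show ?case by (auto simp: g_fun_eq_profile)
next
  case (Suc j)
  have "deriv (\<lambda>v. scaled_profile j (DIM('a) + 2) \<gamma> (u \<bullet> u) v / beta_const TYPE('a) \<gamma>) v
     = scaled_profile (Suc j) (DIM('a) + 2) \<gamma> (u \<bullet> u) v / beta_const TYPE('a) \<gamma>" for v
    using Suc.prems by (intro DERIV_imp_deriv DERIV_cdivide DERIV_scaled_profile) auto
  then show ?case using Suc by (simp del: scaled_profile.simps)
qed

section \<open>Moments of the profile\<close>

text \<open>A closed box, as the gauge integral is differentiated under the integral sign over this set.\<close>

definition centred_cube :: "real \<Rightarrow> 'a::euclidean_space set" where
  "centred_cube R = cbox (- (R *\<^sub>R One)) (R *\<^sub>R One)"

lemma centred_cube_iff: "u \<in> centred_cube R \<longleftrightarrow> (\<forall>b\<in>Basis. \<bar>u \<bullet> b\<bar> \<le> R)"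
  by (auto simp: centred_cube_def mem_box abs_le_iff)

lemma norm_gt_outside_centred_cube: "u \<notin> centred_cube R \<Longrightarrow> R < norm u"
  unfolding centred_cube_iff using Basis_le_norm[of _ u] by force

text \<open>A bridge between the two integrals in use: Lebesgue integrals admit affine substitutions, while the gauge integral
  over a box admits differentiation with respect to a parameter.\<close>

lemma
  fixes f :: "'a::euclidean_space \<Rightarrow> real"
  assumes "continuous_on (centred_cube R) f" "\<And>u. u \<notin> centred_cube R \<Longrightarrow> f u = 0"
  shows integrable_vanishing_outside_cube: "integrable lborel f"
    and lborel_integral_eq_cube: "(LINT u|lborel. f u) = integral (centred_cube R) f"
proof -
  have *: "(\<lambda>x. indicator (centred_cube R) x *\<^sub>R f x) = f"
    using assms(2) by (intro ext) (simp add: indicator_def, blast)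
  have "integrable lborel (\<lambda>x. indicator (centred_cube R) x *\<^sub>R f x)"
    using assms(1) unfolding centred_cube_def by (intro borel_integrable_compact) auto
  then have "set_integrable lborel (centred_cube R) f" by (simp add: set_integrable_def)
  from set_borel_integral_eq_integral(2)[OF this] show "(LINT u|lborel. f u) = integral (centred_cube R) f"
    by (simp only: set_lebesgue_integral_def *)
  show "integrable lborel f" using \<open>integrable lborel (\<lambda>x. _ x *\<^sub>R f x)\<close> by (simp only: *)
qed

lemma lborel_integral_affine:
  fixes f :: "'a::euclidean_space \<Rightarrow> real"
  assumes [measurable]: "f \<in> borel_measurable borel" and c: "c \<noteq> 0"
  shows "(LINT x|lborel. f x) = \<bar>c\<bar> ^ DIM('a) * (LINT x|lborel. f (t + c *\<^sub>R x))"
  by (subst lborel_affine[OF c, of t]) (simp add: integral_density integral_distr)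

lemma lborel_integral_odd:
  fixes f :: "'a::euclidean_space \<Rightarrow> real"
  assumes "f \<in> borel_measurable borel" "\<And>u. f (- u) = - f u"
  shows "(LINT u|lborel. f u) = 0"
  using lborel_integral_affine[OF assms(1), of "-1" 0] assms(2) by simp

lemma lborel_integral_affine_nn:
  fixes f :: "'a::euclidean_space \<Rightarrow> ennreal"
  assumes [measurable]: "f \<in> borel_measurable borel" and c: "c \<noteq> 0"
  shows "(\<integral>\<^sup>+x. f x \<partial>lborel) = ennreal (\<bar>c\<bar> ^ DIM('a)) * (\<integral>\<^sup>+x. f (t + c *\<^sub>R x) \<partial>lborel)"
  by (subst lborel_affine[OF c, of t]) (simp add: nn_integral_density nn_integral_distr nn_integral_cmult)

text \<open>Outside the cube \<open>|u| > R\<close>, so \<open>v u\<close> has left the unit ball.\<close>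

lemma profile_outside_cube:
  fixes u :: "'a::euclidean_space"
  assumes "u \<notin> centred_cube R" "0 < v" "1 \<le> v * R"
  shows "scaled_profile j m a (u \<bullet> u) v = 0"
proof (rule scaled_profile_eq_0)
  have "1 \<le> v * norm u"
    using norm_gt_outside_centred_cube[OF assms(1)] assms(2,3) by (smt (verit) mult_less_cancel_left_pos)
  then have "1 \<le> (v * norm u)\<^sup>2" by (rule one_le_power)
  then show "1 \<le> v\<^sup>2 * (u \<bullet> u)" by (simp add: power_mult_distrib power2_norm_eq_inner)
qed

text \<open>The substitution \<open>w = v u\<close> turns \<open>I 0 v\<close> into \<open>I 0 1\<close>: the Jacobian contributes \<open>v ^ (- d)\<close> and the quadratic
  form \<open>v ^ (- 2)\<close>, which together cancel the factor \<open>v ^ (d + 2)\<close>. So \<open>I 0\<close> is constant, and differentiation under the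
  integral sign shows that its first two derivatives, \<open>I 1\<close> and \<open>I 2\<close>, vanish.\<close>

lemma profile_moment_derivs:
  fixes f :: "'a::euclidean_space \<Rightarrow> real"
  assumes f: "continuous_on UNIV f" "\<And>s u. f (s *\<^sub>R u) = s\<^sup>2 * f u" and a: "2 < a"
  defines "I \<equiv> \<lambda>j v. (LINT u|lborel. f u * scaled_profile j (DIM('a) + 2) a (u \<bullet> u) v)"
  shows "I 1 1 = 0" and "I 2 1 = 0"
proof -
  \<comment> \<open>For \<open>v > 1/2\<close> the integrands all vanish outside the cube of half side length \<open>2\<close>.\<close>
  define U where "U = {1/2<..<(3/2::real)}"
  have cont: "continuous_on S (\<lambda>(v, u). f u * scaled_profile j (DIM('a) + 2) a (u \<bullet> u) v)"
    if "real j < a" for S :: "(real \<times> 'a) set" and j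
    using that unfolding case_prod_beta
    by (intro continuous_on_mult continuous_on_scaled_profile continuous_on_compose2[OF f(1)] continuous_intros) auto
  have cont': "continuous_on S (\<lambda>u. f u * scaled_profile j (DIM('a) + 2) a (u \<bullet> u) v)"
    if "real j < a" for S :: "'a set" and j v
    using that
    by (intro continuous_on_mult continuous_on_scaled_profile continuous_on_compose2[OF f(1)] continuous_intros) auto
  have I_cube: "I j v = integral (centred_cube 2) (\<lambda>u. f u * scaled_profile j (DIM('a) + 2) a (u \<bullet> u) v)"
    if "real j < a" "v \<in> U" for j v
    unfolding I_def using that
    by (intro lborel_integral_eq_cube cont') (auto simp: U_def profile_outside_cube)
  have der: "(I j has_field_derivative I (Suc j) v) (at v)" if j: "real j + 1 < a" and v: "v \<in> U" for j v
  proof -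
    have "((\<lambda>v. integral (centred_cube 2) (\<lambda>u. f u * scaled_profile j (DIM('a) + 2) a (u \<bullet> u) v))
      has_field_derivative integral (centred_cube 2) (\<lambda>u. f u * scaled_profile (Suc j) (DIM('a) + 2) a (u \<bullet> u) v))
      (at v within U)"
      unfolding centred_cube_def
    proof (rule leibniz_rule_field_derivative)
      fix w and u :: 'a
      show "((\<lambda>v. f u * scaled_profile j (DIM('a) + 2) a (u \<bullet> u) v) has_field_derivative
          f u * scaled_profile (Suc j) (DIM('a) + 2) a (u \<bullet> u) w) (at w within U)"
        using j by (intro DERIV_cmult has_field_derivative_at_within[OF DERIV_scaled_profile])
    next
      fix w show "(\<lambda>u. f u * scaled_profile j (DIM('a) + 2) a (u \<bullet> u) w) integrable_on
          cbox (- (2 *\<^sub>R One)) (2 *\<^sub>R One)"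
        using j by (intro integrable_continuous cont') auto
    next
      show "continuous_on (U \<times> cbox (- (2 *\<^sub>R One)) (2 *\<^sub>R One))
          (\<lambda>(v, u::'a). f u * scaled_profile (Suc j) (DIM('a) + 2) a (u \<bullet> u) v)"
        using j by (intro cont) simp
    qed (use v in \<open>auto simp: U_def\<close>)
    moreover have "at v within U = at v" using v by (intro at_within_open) (auto simp: U_def)
    moreover have "I (Suc j) v = integral (centred_cube 2) (\<lambda>u. f u * scaled_profile (Suc j) (DIM('a) + 2) a (u \<bullet> u) v)"
      using j v by (intro I_cube) auto
    ultimately have "((\<lambda>v. integral (centred_cube 2) (\<lambda>u. f u * scaled_profile j (DIM('a) + 2) a (u \<bullet> u) v))
      has_field_derivative I (Suc j) v) (at v)"
      by (simp only:)
    moreover have "eventually (\<lambda>v. I j v = integral (centred_cube 2) (\<lambda>u. f u * scaled_profile j (DIM('a) + 2) a (u \<bullet> u) v)) (nhds v)"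
      using v j by (intro eventually_nhds_in_open[THEN eventually_mono[OF _ I_cube], of U]) (auto simp: U_def)
    ultimately show ?thesis by (simp only: DERIV_cong_ev[OF refl _ refl])
  qed
  have const: "I 0 v = I 0 1" if v: "v \<in> U" for v
  proof -
    have meas: "(\<lambda>w. f w * scaled_profile 0 (DIM('a) + 2) a (w \<bullet> w) 1) \<in> borel_measurable borel"
      using a by (intro borel_measurable_continuous_onI cont') auto
    have "I 0 1 = \<bar>v\<bar> ^ DIM('a) * (LINT u|lborel. f (0 + v *\<^sub>R u) *
        scaled_profile 0 (DIM('a) + 2) a ((0 + v *\<^sub>R u) \<bullet> (0 + v *\<^sub>R u)) 1)"
      unfolding I_def using v by (intro lborel_integral_affine[OF meas]) (auto simp: U_def)
    also have "\<dots> = (LINT u|lborel. \<bar>v\<bar> ^ DIM('a) * (f (0 + v *\<^sub>R u) *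
        scaled_profile 0 (DIM('a) + 2) a ((0 + v *\<^sub>R u) \<bullet> (0 + v *\<^sub>R u)) 1))"
      by simp
    also have "\<dots> = I 0 v"
      unfolding I_def using v
      by (intro Bochner_Integration.integral_cong)
         (auto simp: U_def f(2) power_add power2_eq_square mult_ac)
    finally show ?thesis by simp
  qed
  have zero: "J' v = 0" if "\<And>v. v \<in> U \<Longrightarrow> (J has_field_derivative J' v) (at v)"
    "\<And>v. v \<in> U \<Longrightarrow> J v = k" and v: "v \<in> U" for J J' :: "real \<Rightarrow> real" and k v
  proof -
    have ev: "eventually (\<lambda>v. J v = k) (nhds v)"
      using v that(2) by (intro eventually_nhds_in_open[THEN eventually_mono, of U]) (auto simp: U_def)
    have "((\<lambda>_. k) has_field_derivative J' v) (at v)"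
      using that(1)[OF v] DERIV_cong_ev[OF refl ev refl] by simp
    then show ?thesis using DERIV_unique[OF _ DERIV_const] by blast
  qed
  have I1: "I 1 v = 0" if "v \<in> U" for v
    using zero[of "I 0" "I 1" "I 0 1" v] der[of 0] const that a by simp
  have "I 2 v = 0" if "v \<in> U" for v
    using zero[of "I 1" "I 2" 0 v] der[of 1] I1 that a by (simp add: numeral_2_eq_2)
  then show "I 1 1 = 0" "I 2 1 = 0" using I1[of 1] by (auto simp: U_def)
qed

text \<open>At \<open>v = 1\<close> the factor \<open>v ^ m\<close> is invisible, so the same integral serves for every \<open>m\<close>.\<close>

lemma beta_const_eq_LINT:
  assumes "0 < \<gamma>"
  shows "beta_const TYPE('a::euclidean_space) \<gamma> = (LINT u|lborel. scaled_profile 0 m \<gamma> ((u::'a) \<bullet> u) 1)"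
  unfolding beta_const_def set_lebesgue_integral_def
proof (rule Bochner_Integration.integral_cong[OF refl])
  fix u :: 'a
  show "indicat_real (cball 0 1) u *\<^sub>R (1 - u \<bullet> u) powr \<gamma> = scaled_profile 0 m \<gamma> (u \<bullet> u) 1"
  proof (cases "norm u \<le> 1")
    case True
    then have "u \<bullet> u \<le> 1" by (simp add: power2_norm_eq_inner[symmetric] power_le_one)
    with True show ?thesis by simp
  next
    case False
    then have "1 < u \<bullet> u" unfolding power2_norm_eq_inner[symmetric] by (intro one_less_power) auto
    with False show ?thesis by simp
  qed
qed

lemma integrable_profile:
  "0 < a \<Longrightarrow> integrable lborel (\<lambda>u::'a::euclidean_space. scaled_profile 0 m a (u \<bullet> u) 1)"
  by (rule integrable_vanishing_outside_cube[where R=1])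
    (auto intro!: continuous_on_scaled_profile continuous_intros profile_outside_cube simp del: scaled_profile.simps)

lemma beta_const_pos:
  assumes "0 < \<gamma>"
  shows "0 < beta_const TYPE('a::euclidean_space) \<gamma>"
proof -
  let ?f = "\<lambda>u::'a. scaled_profile 0 0 \<gamma> (u \<bullet> u) 1"
  have "0 < (LINT u|lborel. ?f u)"
  proof (rule ccontr)
    assume "\<not> ?thesis"
    moreover have "0 \<le> (LINT u|lborel. ?f u)" by (intro Bochner_Integration.integral_nonneg) simp
    ultimately have "(LINT u|lborel. ?f u) = 0" by linarith
    then have "AE u in lborel. ?f u = 0"
      using integral_nonneg_eq_0_iff_AE[OF integrable_profile[OF assms, of 0]]
      by (metis (mono_tags, lifting) AE_I2 mult_nonneg_nonneg powr_ge_zero scaled_profile.simps(1) zero_le_one power_one)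
    then have "AE u::'a in lborel. u \<notin> ball 0 1"
    proof eventually_elim
      case (elim u)
      then have "1 \<le> u \<bullet> u" by (auto simp: max_def split: if_splits)
      then have "1 \<le> norm u" using power_le_one_iff[of "norm u" 2] by (simp add: power2_norm_eq_inner[symmetric]) (smt (verit) one_le_power power_strict_mono one_power2 norm_ge_zero zero_less_numeral)
      then show ?case by simp
    qed
    moreover have "(AE u::'a in lborel. u \<notin> ball 0 1) \<longleftrightarrow> emeasure lborel (ball (0::'a) 1) = 0"
      by (rule AE_iff_measurable) (auto simp: ball_def dist_norm)
    ultimately have "emeasure lborel (ball (0::'a) 1) = 0" by blast
    then show False
      using content_ball_pos[of 1 "0::'a"] by (simp add: measure_def)
  qed
  then show ?thesis unfolding beta_const_eq_LINT[OF assms, of 0] .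
qed

lemma beta_Q_eq_LINT:
  assumes "0 < \<gamma>"
  shows "beta_Q TYPE('a::euclidean_space) \<gamma> =
    (LINT u|lborel. scaled_profile 0 m (2 * \<gamma>) ((u::'a) \<bullet> u) 1) / (beta_const TYPE('a) \<gamma>)\<^sup>2"
proof -
  have "beta_Q TYPE('a::euclidean_space) \<gamma> =
     (LINT u|lborel. scaled_profile 0 m (2 * \<gamma>) ((u::'a) \<bullet> u) 1 / (beta_const TYPE('a) \<gamma>)\<^sup>2)"
    unfolding beta_Q_def
  proof (rule Bochner_Integration.integral_cong[OF refl])
    fix u :: 'a
    show "(beta_kernel \<gamma> u)\<^sup>2 = scaled_profile 0 m (2 * \<gamma>) (u \<bullet> u) 1 / (beta_const TYPE('a) \<gamma>)\<^sup>2"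
      using beta_kernel_eq_profile[of \<gamma> 1 u]
      by (simp add: power_divide power2_eq_square powr_add[symmetric])
  qed
  then show ?thesis by simp
qed

lemma beta_Q_pos:
  assumes "0 < \<gamma>"
  shows "0 < beta_Q TYPE('a::euclidean_space) \<gamma>"
  using assms beta_const_pos[of \<gamma>, where 'a='a] beta_const_pos[of "2 * \<gamma>", where 'a='a]
  unfolding beta_Q_eq_LINT[OF assms, of 0] by (subst beta_const_eq_LINT[symmetric]) auto

section \<open>Expansion along lines\<close>

text \<open>\<open>line_deriv j m a c x u t\<close> is, for \<open>j \<le> 4 < a\<close> and smooth \<open>c\<close>, the \<open>j\<close>-th derivative at \<open>t\<close> of
  \<open>t \<mapsto> scaled_profile 0 m a |u|\<^sup>2 (c (x + t u))\<close>; the right-hand sides are the formulas of Faa di Bruno. The last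
  equation is meant for \<open>j = 4\<close>; its values for larger \<open>j\<close> have no meaning.\<close>

fun line_deriv :: "nat \<Rightarrow> nat \<Rightarrow> real \<Rightarrow> ('a::euclidean_space \<Rightarrow> real) \<Rightarrow> 'a \<Rightarrow> 'a \<Rightarrow> real \<Rightarrow> real" where
  "line_deriv 0 m a c x u t = scaled_profile 0 m a (u \<bullet> u) (c (x + t *\<^sub>R u))"
| "line_deriv (Suc 0) m a c x u t =
    (let G = \<lambda>j. scaled_profile j m a (u \<bullet> u) (c (x + t *\<^sub>R u)); D = \<lambda>r. diff_form r c (x + t *\<^sub>R u) u
     in G 1 * D 1)"
| "line_deriv (Suc (Suc 0)) m a c x u t =
    (let G = \<lambda>j. scaled_profile j m a (u \<bullet> u) (c (x + t *\<^sub>R u)); D = \<lambda>r. diff_form r c (x + t *\<^sub>R u) u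
     in G 2 * (D 1)\<^sup>2 + G 1 * D 2)"
| "line_deriv (Suc (Suc (Suc 0))) m a c x u t =
    (let G = \<lambda>j. scaled_profile j m a (u \<bullet> u) (c (x + t *\<^sub>R u)); D = \<lambda>r. diff_form r c (x + t *\<^sub>R u) u
     in G 3 * D 1 ^ 3 + 3 * G 2 * D 1 * D 2 + G 1 * D 3)"
| "line_deriv (Suc (Suc (Suc (Suc _)))) m a c x u t =
    (let G = \<lambda>j. scaled_profile j m a (u \<bullet> u) (c (x + t *\<^sub>R u)); D = \<lambda>r. diff_form r c (x + t *\<^sub>R u) u
     in G 4 * D 1 ^ 4 + 6 * G 3 * (D 1)\<^sup>2 * D 2 + G 2 * (4 * D 1 * D 3 + 3 * (D 2)\<^sup>2) + G 1 * D 4)"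

lemma DERIV_line_deriv:
  assumes W: "open W" "x + t *\<^sub>R u \<in> W" and c: "times_cont_differentiable_on 4 c W"
    and a: "4 < a" and j: "j < 4"
  shows "(line_deriv j m a c x u has_field_derivative line_deriv (Suc j) m a c x u t) (at t)"
proof -
  note D [derivative_intros] = DERIV_diff_form_line[OF W c]
  have D0: "((\<lambda>s. c (x + s *\<^sub>R u)) has_field_derivative diff_form 1 c (x + t *\<^sub>R u) u) (at t)"
    using D[of 0] by (simp add: diff_form_0)
  have G: "((\<lambda>s. scaled_profile i m a (u \<bullet> u) (c (x + s *\<^sub>R u))) has_field_derivative
      scaled_profile (Suc i) m a (u \<bullet> u) (c (x + t *\<^sub>R u)) * diff_form 1 c (x + t *\<^sub>R u) u) (at t)"
    if "i < 4" for i
    using that a by (intro DERIV_chain2[OF DERIV_scaled_profile D0]) auto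
  \<comment> \<open>Naming the factors as functions of the single variable \<open>s\<close> keeps the product rule from unfolding them.\<close>
  define GG where "GG i s = scaled_profile i m a (u \<bullet> u) (c (x + s *\<^sub>R u))" for i s
  define DD where "DD r s = diff_form r c (x + s *\<^sub>R u) u" for r s
  have G': "(GG i has_field_derivative GG (Suc i) t * DD 1 t) (at t)" if "i < 4" for i
    using G[OF that] by (simp add: GG_def[abs_def] DD_def[abs_def] del: scaled_profile.simps)
  have D': "(DD r has_field_derivative DD (Suc r) t) (at t)" if "r < 4" for r
    using D[OF that] by (simp add: DD_def[abs_def])
  have GN: "(GG 1 has_field_derivative GG 2 t * DD 1 t) (at t)"
     "(GG 2 has_field_derivative GG 3 t * DD 1 t) (at t)" "(GG 3 has_field_derivative GG 4 t * DD 1 t) (at t)"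
    using G'[of 1] G'[of 2] G'[of 3] by (simp_all add: numeral_eq_Suc)
  have DN: "(DD 1 has_field_derivative DD 2 t) (at t)"
     "(DD 2 has_field_derivative DD 3 t) (at t)" "(DD 3 has_field_derivative DD 4 t) (at t)"
    using D'[of 1] D'[of 2] D'[of 3] by (simp_all add: numeral_eq_Suc)
  have eq: "line_deriv 0 m a c x u = GG 0"
    "line_deriv 1 m a c x u = (\<lambda>s. GG 1 s * DD 1 s)"
    "line_deriv 2 m a c x u = (\<lambda>s. GG 2 s * (DD 1 s)\<^sup>2 + GG 1 s * DD 2 s)"
    "line_deriv 3 m a c x u = (\<lambda>s. GG 3 s * DD 1 s ^ 3 + 3 * GG 2 s * DD 1 s * DD 2 s + GG 1 s * DD 3 s)"
    "line_deriv 4 m a c x u = (\<lambda>s. GG 4 s * DD 1 s ^ 4 + 6 * GG 3 s * (DD 1 s)\<^sup>2 * DD 2 s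
        + GG 2 s * (4 * DD 1 s * DD 3 s + 3 * (DD 2 s)\<^sup>2) + GG 1 s * DD 4 s)"
    by (auto simp: GG_def DD_def Let_def fun_eq_iff numeral_eq_Suc simp del: scaled_profile.simps)
  consider "j = 0" | "j = 1" | "j = 2" | "j = 3" using j by linarith
  then show ?thesis
  proof cases
    case 1
    then show ?thesis using G'[of 0] eq(1,2) by (simp del: line_deriv.simps)
  next
    case 2
    have "((\<lambda>s. GG 1 s * DD 1 s) has_field_derivative line_deriv 2 m a c x u t) (at t)"
      unfolding eq by (rule derivative_eq_intros GN DN refl)+ (simp add: power2_eq_square algebra_simps)
    then show ?thesis unfolding 2 eq(2) by (simp add: numeral_eq_Suc del: line_deriv.simps)
  next
    case 3
    have "((\<lambda>s. GG 2 s * (DD 1 s)\<^sup>2 + GG 1 s * DD 2 s) has_field_derivative line_deriv 3 m a c x u t) (at t)"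
      unfolding eq by (rule derivative_eq_intros GN DN refl)+ (simp add: power2_eq_square power3_eq_cube algebra_simps)
    then show ?thesis unfolding 3 eq(3) by (simp add: numeral_eq_Suc del: line_deriv.simps)
  next
    case 4
    have "((\<lambda>s. GG 3 s * DD 1 s ^ 3 + 3 * GG 2 s * DD 1 s * DD 2 s + GG 1 s * DD 3 s)
        has_field_derivative line_deriv 4 m a c x u t) (at t)"
      unfolding eq by (rule derivative_eq_intros GN DN refl)+
        (simp add: power2_eq_square power3_eq_cube power4_eq_xxxx algebra_simps)
    then show ?thesis unfolding 4 eq(4) by (simp add: numeral_eq_Suc del: line_deriv.simps)
  qed
qed

lemma continuous_on_line_deriv:
  fixes c :: "'a::euclidean_space \<Rightarrow> real"
  assumes c: "times_cont_differentiable_on 4 c W"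
    and S: "\<And>z. z \<in> S \<Longrightarrow> x + t z *\<^sub>R u z \<in> W" "continuous_on S t" "continuous_on S u"
    and a: "4 < a" and j: "j \<le> 4"
  shows "continuous_on S (\<lambda>z. line_deriv j m a c x (u z) (t z))"
proof -
  have p: "continuous_on S (\<lambda>z. x + t z *\<^sub>R u z)" "(\<lambda>z. x + t z *\<^sub>R u z) ` S \<subseteq> W"
    using S by (auto intro!: continuous_intros)
  have D [continuous_intros]: "continuous_on S (\<lambda>z. diff_form r c (x + t z *\<^sub>R u z) (u z))" if "r \<le> 4" for r
    using c that by (intro continuous_on_diff_form[of _ W] p S(3)) (auto simp: times_cont_differentiable_on_def)
  have G [continuous_intros]: "continuous_on S (\<lambda>z. scaled_profile i m a (u z \<bullet> u z) (c (x + t z *\<^sub>R u z)))" if "i \<le> 4" for i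
    using D[of 0] S(3) that a by (intro continuous_on_scaled_profile continuous_on_inner) (auto simp: diff_form_0)
  consider "j = 0" | "j = Suc 0" | "j = Suc (Suc 0)" | "j = Suc (Suc (Suc 0))" | "j = Suc (Suc (Suc (Suc 0)))"
    using j by linarith
  then show ?thesis
    by cases (simp_all only: line_deriv.simps Let_def, auto intro!: continuous_intros simp del: scaled_profile.simps)
qed

lemma line_deriv_reflect:
  assumes "j \<le> 4"
  shows "line_deriv j m a c x (- u) 0 = (-1) ^ j * line_deriv j m a c x u 0"
proof -
  have D: "diff_form r c x (- u) = (-1) ^ r * diff_form r c x u" for r
    using diff_form_scaleR[of r c x "-1" u] by simp
  consider "j = 0" | "j = Suc 0" | "j = Suc (Suc 0)" | "j = Suc (Suc (Suc 0))" | "j = Suc (Suc (Suc (Suc 0)))"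
    using assms by linarith
  then show ?thesis
    by cases (simp_all add: Let_def D power_mult_distrib algebra_simps del: scaled_profile.simps)
qed

lemma line_stays_in_open:
  fixes x :: "'a::euclidean_space"
  assumes "open W" "x \<in> W"
  obtains \<delta> where "0 < \<delta>" "\<And>t u. \<bar>t\<bar> < \<delta> \<Longrightarrow> u \<in> centred_cube R \<Longrightarrow> x + t *\<^sub>R u \<in> W"
proof -
  obtain e where e: "0 < e" "ball x e \<subseteq> W" using assms by (auto simp: open_contains_ball)
  have "bounded (centred_cube R :: 'a set)" by (simp add: centred_cube_def)
  then obtain K where K: "0 < K" "\<And>u::'a. u \<in> centred_cube R \<Longrightarrow> norm u \<le> K"
    by (auto simp: bounded_pos)
  show ?thesis
  proof
    show "0 < e / K" using e K by simp
    fix t and u :: 'a assume t: "\<bar>t\<bar> < e / K" and u: "u \<in> centred_cube R"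
    have "\<bar>t\<bar> * norm u \<le> \<bar>t\<bar> * K" using K(2)[OF u] by (intro mult_left_mono) auto
    also have "\<dots> < e" using t K by (simp add: field_simps)
    finally show "x + t *\<^sub>R u \<in> W" using e by (auto simp: dist_norm)
  qed
qed

text \<open>Differentiation under the integral sign, followed by Taylor's formula with Lagrange remainder at an intermediate
  point \<open>s t\<close>, which tends to zero with \<open>t\<close>. For the limit of the remainder it is enough that the fourth derivative of
  the integral is continuous at zero.\<close>

lemma
  fixes c :: "'a::euclidean_space \<Rightarrow> real" and R :: real and m :: nat
  assumes W: "open W" "x \<in> W" and c: "times_cont_differentiable_on 4 c W" and a: "4 < a"
  defines "F \<equiv> \<lambda>j t. integral (centred_cube R) (\<lambda>u. line_deriv j m a c x u t)"
  shows DERIV_integral_line_deriv: "(F 0 has_field_derivative F 1 0) (at 0)"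
    and taylor_integral_line_deriv:
      "((\<lambda>t. (F 0 t - (\<Sum>j<4. F j 0 / fact j * t ^ j)) / t ^ 4) \<longlongrightarrow> F 4 0 / 24) (at_right 0)"
proof -
  obtain \<delta> where \<delta>: "0 < \<delta>" "\<And>t u. \<bar>t\<bar> < \<delta> \<Longrightarrow> u \<in> centred_cube R \<Longrightarrow> x + t *\<^sub>R u \<in> W"
    using line_stays_in_open[OF W] by metis
  define U where "U = {-\<delta><..<\<delta>}"
  have U: "open U" "convex U" "0 \<in> U" using \<delta> by (auto simp: U_def)
  have inW: "x + t *\<^sub>R u \<in> W" if "t \<in> U" "u \<in> centred_cube R" for t u
    using that \<delta>(2) by (auto simp: U_def)
  have joint: "continuous_on (U \<times> centred_cube R) (\<lambda>(t, u). line_deriv j m a c x u t)" if "j \<le> 4" for j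
    unfolding case_prod_beta
    using that inW by (intro continuous_on_line_deriv[OF c _ _ _ a]) (auto intro!: continuous_intros)
  have single: "continuous_on (centred_cube R) (\<lambda>u. line_deriv j m a c x u t)" if "j \<le> 4" "t \<in> U" for j t
    using that inW by (intro continuous_on_line_deriv[OF c _ _ _ a]) (auto intro!: continuous_intros)
  have der: "(F j has_field_derivative F (Suc j) t) (at t)" if j: "j < 4" and t: "t \<in> U" for j t
  proof -
    have "(F j has_field_derivative F (Suc j) t) (at t within U)"
      unfolding F_def centred_cube_def
    proof (rule leibniz_rule_field_derivative)
      fix s and u :: 'a assume "s \<in> U" "u \<in> cbox (- (R *\<^sub>R One)) (R *\<^sub>R One)"
      then show "((\<lambda>t. line_deriv j m a c x u t) has_field_derivative line_deriv (Suc j) m a c x u s) (at s within U)"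
        using inW j a by (intro has_field_derivative_at_within[OF DERIV_line_deriv[OF W(1) _ c]]) (auto simp: centred_cube_def)
    next
      fix s assume "s \<in> U"
      then show "(\<lambda>u. line_deriv j m a c x u s) integrable_on cbox (- (R *\<^sub>R One)) (R *\<^sub>R One)"
        using single[of j s] j by (intro integrable_continuous) (auto simp: centred_cube_def)
    next
      show "continuous_on (U \<times> cbox (- (R *\<^sub>R One)) (R *\<^sub>R One)) (\<lambda>(t, u). line_deriv (Suc j) m a c x u t)"
        using joint[of "Suc j"] j by (simp add: centred_cube_def del: line_deriv.simps)
    qed (use t U in auto)
    then show ?thesis using at_within_open[OF t U(1)] by simp
  qed
  show "(F 0 has_field_derivative F 1 0) (at 0)" using der[of 0 0] U by (simp del: line_deriv.simps)
  have "continuous_on U (F 4)"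
    unfolding F_def centred_cube_def
    using joint[of 4] by (intro integral_continuous_on_param) (simp add: centred_cube_def del: line_deriv.simps)
  then have F4: "isCont (F 4) 0" using U by (simp add: continuous_on_eq_continuous_at)
  have mac: "\<exists>s. 0 < s \<and> s < t \<and> F 0 t = (\<Sum>j<4. F j 0 / fact j * t ^ j) + F 4 s / fact 4 * t ^ 4"
    if t: "0 < t" "t < \<delta>" for t
    using t by (intro Maclaurin) (auto intro!: der simp: U_def simp del: line_deriv.simps)
  have "\<forall>t. \<exists>s. 0 < t \<and> t < \<delta> \<longrightarrow> 0 < s \<and> s < t \<and>
      F 0 t = (\<Sum>j<4. F j 0 / fact j * t ^ j) + F 4 s / fact 4 * t ^ 4"
    using mac by blast
  then obtain s where s: "\<forall>t. 0 < t \<and> t < \<delta> \<longrightarrow> 0 < s t \<and> s t < t \<and>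
      F 0 t = (\<Sum>j<4. F j 0 / fact j * t ^ j) + F 4 (s t) / fact 4 * t ^ 4"
    by (rule choice[THEN exE])
  have ev: "eventually (\<lambda>t. 0 < t \<and> t < \<delta>) (at_right (0::real))"
    using \<delta>(1) by (auto simp: eventually_at_right[of 0 1] intro!: exI[of _ \<delta>])
  have "(s \<longlongrightarrow> 0) (at_right 0)"
  proof (rule tendsto_sandwich)
    show "eventually (\<lambda>t. 0 \<le> s t) (at_right 0)" "eventually (\<lambda>t. s t \<le> t) (at_right 0)"
      using ev by (eventually_elim, use s in force)+
  qed (auto intro!: tendsto_intros)
  then have "((\<lambda>t. F 4 (s t) / 24) \<longlongrightarrow> F 4 0 / 24) (at_right 0)"
    by (intro tendsto_divide tendsto_const isCont_tendsto_compose[OF F4]) auto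
  then show "((\<lambda>t. (F 0 t - (\<Sum>j<4. F j 0 / fact j * t ^ j)) / t ^ 4) \<longlongrightarrow> F 4 0 / 24) (at_right 0)"
  proof (rule Lim_transform_eventually)
    show "eventually (\<lambda>t. F 4 (s t) / 24 = (F 0 t - (\<Sum>j<4. F j 0 / fact j * t ^ j)) / t ^ 4) (at_right 0)"
      using ev
    proof eventually_elim
      case (elim t)
      then have "F 0 t - (\<Sum>j<4. F j 0 / fact j * t ^ j) = F 4 (s t) / 24 * t ^ 4"
        using s[rule_format, of t] by (simp add: fact_numeral)
      then show ?case using elim by simp
    qed
  qed
qed

lemma A_fun_eq_line_deriv:
  fixes x0 :: "'a::euclidean_space"
  assumes "4 < \<gamma>" "weight lam x0 x0 = 1"
  shows "A_fun \<gamma> lam x0 u = line_deriv 4 (DIM('a) + 2) \<gamma> (weight lam x0) x0 u 0 / (24 * beta_const TYPE('a) \<gamma>)"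
proof -
  have d: "(deriv ^^ k) (g_fun \<gamma> u) 1 = scaled_profile k (DIM('a) + 2) \<gamma> (u \<bullet> u) 1 / beta_const TYPE('a) \<gamma>"
    if "k \<le> 4" for k
    using that assms(1) by (subst higher_deriv_g_fun) auto
  have d1: "(deriv ^^ Suc 0) (g_fun \<gamma> u) 1 = scaled_profile (Suc 0) (DIM('a) + 2) \<gamma> (u \<bullet> u) 1 / beta_const TYPE('a) \<gamma>"
    using d[of "Suc 0"] by (simp del: scaled_profile.simps funpow.simps)
  have dd: "(deriv ^^ 2) (g_fun \<gamma> u) 1 = scaled_profile 2 (DIM('a) + 2) \<gamma> (u \<bullet> u) 1 / beta_const TYPE('a) \<gamma>"
    "(deriv ^^ 3) (g_fun \<gamma> u) 1 = scaled_profile 3 (DIM('a) + 2) \<gamma> (u \<bullet> u) 1 / beta_const TYPE('a) \<gamma>"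
    "(deriv ^^ 4) (g_fun \<gamma> u) 1 = scaled_profile 4 (DIM('a) + 2) \<gamma> (u \<bullet> u) 1 / beta_const TYPE('a) \<gamma>"
    by (rule d, simp)+
  have four: "line_deriv 4 = line_deriv (Suc (Suc (Suc (Suc 0))))" by (simp add: numeral_eq_Suc)
  show ?thesis
    unfolding A_fun_def Let_def four line_deriv.simps One_nat_def d1 dd
    using assms beta_const_pos[of \<gamma>, where 'a='a] by (simp add: field_simps del: scaled_profile.simps funpow.simps)
qed

lemma line_deriv_0_outside:
  assumes "c x = 1" "u \<notin> centred_cube R" "1 \<le> R"
  shows "line_deriv j m a c x u 0 = 0"
proof -
  have "scaled_profile i m a (u \<bullet> u) 1 = 0" for i
    using assms by (intro profile_outside_cube) auto
  then show ?thesis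
    using assms(1) by (cases "(j, m, a, c, x, u, 0::real)" rule: line_deriv.cases) (simp_all add: Let_def del: scaled_profile.simps)
qed

lemma line_deriv_0_LINT:
  fixes c :: "'a::euclidean_space \<Rightarrow> real"
  assumes c: "times_cont_differentiable_on 4 c W" "x \<in> W" "c x = 1" and a: "4 < a" and R: "1 \<le> R" and j: "j \<le> 4"
  shows "integrable lborel (\<lambda>u. line_deriv j m a c x u 0)"
    and "integral (centred_cube R) (\<lambda>u. line_deriv j m a c x u 0) = (LINT u|lborel. line_deriv j m a c x u 0)"
proof -
  have cont: "continuous_on (centred_cube R) (\<lambda>u. line_deriv j m a c x u 0)"
    using c by (intro continuous_on_line_deriv[OF c(1) _ _ _ a j]) (auto intro!: continuous_intros)
  show "integrable lborel (\<lambda>u. line_deriv j m a c x u 0)"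
    by (rule integrable_vanishing_outside_cube[OF cont]) (rule line_deriv_0_outside[of c x, OF c(3) _ R])
  show "integral (centred_cube R) (\<lambda>u. line_deriv j m a c x u 0) = (LINT u|lborel. line_deriv j m a c x u 0)"
    by (rule lborel_integral_eq_cube[symmetric, OF cont]) (rule line_deriv_0_outside[of c x, OF c(3) _ R])
qed

text \<open>At \<open>t = 0\<close> the integrand involves \<open>u\<close> through \<open>|u|\<^sup>2\<close> and a form of degree \<open>j\<close>, so it is odd when \<open>j\<close> is.\<close>

lemma LINT_line_deriv_odd:
  fixes c :: "'a::euclidean_space \<Rightarrow> real"
  assumes c: "times_cont_differentiable_on 4 c W" "x \<in> W" "c x = 1" and a: "4 < a" and j: "j \<le> 4" "odd j"
  shows "(LINT u|lborel. line_deriv j m a c x u 0) = 0"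
proof (rule lborel_integral_odd)
  show "(\<lambda>u. line_deriv j m a c x u 0) \<in> borel_measurable borel"
    using borel_measurable_integrable[OF line_deriv_0_LINT(1)[OF c a order_refl j(1), of m]]
    by (simp del: line_deriv.simps)
  show "line_deriv j m a c x (- u) 0 = - line_deriv j m a c x u 0" for u
    using j(2) by (simp only: line_deriv_reflect[OF j(1)] power_minus_odd power_one) simp
qed

text \<open>Both \<open>(Dc u)\<^sup>2\<close> and \<open>D\<^sup>2c(u, u)\<close> are quadratic in \<open>u\<close>, so each of the two summands integrates to zero. This is what
  removes the term of order \<open>h\<^sup>2\<close> from the bias and is the reason for the square root in the weight.\<close>

lemma LINT_line_deriv_2:
  fixes c :: "'a::euclidean_space \<Rightarrow> real"
  assumes c: "times_cont_differentiable_on 4 c W" "x \<in> W" "c x = 1" and a: "4 < a"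
  shows "(LINT u|lborel. line_deriv 2 (DIM('a) + 2) a c x u 0) = 0"
proof -
  let ?G = "\<lambda>j u. scaled_profile j (DIM('a) + 2) a (u \<bullet> u) 1"
  have contD: "continuous_on UNIV (\<lambda>u. diff_form r c x u)" if "r \<le> 4" for r
    using c that by (intro continuous_on_diff_form[where W=W]) (auto simp: times_cont_differentiable_on_def)
  have int: "integrable lborel (\<lambda>u::'a. f u * ?G j u)" if "continuous_on UNIV f" "j \<le> 4" for f j
    using that a
    by (intro integrable_vanishing_outside_cube[where R=1] continuous_on_mult continuous_on_scaled_profile)
       (auto intro!: continuous_intros profile_outside_cube intro: continuous_on_subset simp del: scaled_profile.simps)
  have "(LINT u|lborel. line_deriv 2 (DIM('a) + 2) a c x u 0) =
      (LINT u|lborel. (diff_form 1 c x u)\<^sup>2 * ?G 2 u + diff_form 2 c x u * ?G 1 u)"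
    using c(3) by (simp add: numeral_2_eq_2 Let_def mult.commute del: scaled_profile.simps)
  also have "\<dots> = (LINT u|lborel. (diff_form 1 c x u)\<^sup>2 * ?G 2 u) + (LINT u|lborel. diff_form 2 c x u * ?G 1 u)"
    by (intro Bochner_Integration.integral_add int continuous_on_power contD) auto
  also have "\<dots> = 0"
    using profile_moment_derivs(2)[of "\<lambda>u. (diff_form 1 c x u)\<^sup>2" a] profile_moment_derivs(1)[of "diff_form 2 c x" a] a
    by (simp add: contD continuous_on_power diff_form_scaleR power_mult_distrib del: scaled_profile.simps)
  finally show ?thesis .
qed

lemma bias_expansion:
  fixes x0 :: "'a::euclidean_space"
  assumes W: "open W" "x0 \<in> W" and c: "times_cont_differentiable_on 4 (weight lam x0) W" "weight lam x0 x0 = 1"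
    and \<gamma>: "4 < \<gamma>" and R: "1 \<le> R"
  shows "((\<lambda>t. (integral (centred_cube R) (\<lambda>u. line_deriv 0 (DIM('a) + 2) \<gamma> (weight lam x0) x0 u t)
            / beta_const TYPE('a) \<gamma> - 1) / t ^ 4)
          \<longlongrightarrow> (LINT u|lborel. A_fun \<gamma> lam x0 u)) (at_right 0)"
proof -
  let ?c = "weight lam x0" and ?K = "beta_const TYPE('a) \<gamma>"
  define F where "F j t = integral (centred_cube R) (\<lambda>u. line_deriv j (DIM('a) + 2) \<gamma> ?c x0 u t)" for j t
  have K: "0 < ?K" using \<gamma> by (intro beta_const_pos) simp
  have F_LINT: "F j 0 = (LINT u|lborel. line_deriv j (DIM('a) + 2) \<gamma> ?c x0 u 0)" if "j \<le> 4" for j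
    unfolding F_def by (rule line_deriv_0_LINT(2)[OF c(1) W(2) c(2) \<gamma> R that])
  have F0: "F 0 0 = ?K"
    using \<gamma> c(2) beta_const_eq_LINT[of \<gamma> "DIM('a) + 2", where 'a='a] by (simp add: F_LINT del: scaled_profile.simps)
  have F13: "F 1 0 = 0" "F 3 0 = 0"
    by (simp_all add: F_LINT LINT_line_deriv_odd[OF c(1) W(2) c(2) \<gamma>] del: line_deriv.simps)
  have F2: "F 2 0 = 0"
    using LINT_line_deriv_2[OF c(1) W(2) c(2) \<gamma>] by (simp add: F_LINT)
  have F4: "F 4 0 / 24 / ?K = (LINT u|lborel. A_fun \<gamma> lam x0 u)"
    using A_fun_eq_line_deriv[OF \<gamma> c(2)] by (simp add: F_LINT field_simps)
  have "(\<Sum>j<4. F j 0 / fact j * t ^ j) = ?K" for t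
    using F0 F13 F2 by (simp add: lessThan_Suc numeral_eq_Suc)
  then have lim: "((\<lambda>t. (F 0 t - ?K) / t ^ 4) \<longlongrightarrow> F 4 0 / 24) (at_right 0)"
    using taylor_integral_line_deriv[OF W c(1) \<gamma>, of R "DIM('a) + 2"] by (simp add: F_def del: line_deriv.simps)
  have "((\<lambda>t. (F 0 t - ?K) / t ^ 4 / ?K) \<longlongrightarrow> F 4 0 / 24 / ?K) (at_right 0)"
    using K by (intro tendsto_divide[OF lim tendsto_const]) simp
  moreover have "(\<lambda>t. (F 0 t - ?K) / t ^ 4 / ?K) = (\<lambda>t. (F 0 t / ?K - 1) / t ^ 4)"
    using K by (auto simp: field_simps)
  ultimately show ?thesis using F4 by (simp add: F_def del: line_deriv.simps)
qed

section \<open>The estimator in rescaled coordinates\<close>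

text \<open>Substitute \<open>y = x + h u\<close>. Outside the cube either \<open>x + h u\<close> is not in \<open>W\<close>, or \<open>c(x + h u) |u| \<ge> l R \<ge> 1\<close>; in both cases
  the integrand is zero. The last assumption on \<open>h\<close> says that, conversely, the boundary of \<open>W\<close> is not felt inside the
  cube.\<close>

lemma nn_integral_rescaled_profile:
  fixes c :: "'a::euclidean_space \<Rightarrow> real"
  assumes W: "open W" and c: "continuous_on W c" "\<And>y. y \<in> W \<Longrightarrow> l \<le> c y" and l: "0 < l" "1 \<le> l * R"
    and h: "0 < h" "\<And>u. u \<in> centred_cube R \<Longrightarrow> x + h *\<^sub>R u \<in> W" and a: "0 < a"
  shows "(\<integral>\<^sup>+y\<in>W. ennreal (scaled_profile 0 m a (((x - y) /\<^sub>R h) \<bullet> ((x - y) /\<^sub>R h)) (c y)) \<partial>lborel)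
      = ennreal (h ^ DIM('a) * integral (centred_cube R) (\<lambda>u. line_deriv 0 m a c x u h))"
    and "0 \<le> integral (centred_cube R) (\<lambda>u. line_deriv 0 m a c x u h)"
proof -
  define f where "f y = indicator W y *\<^sub>R scaled_profile 0 m a (((x - y) /\<^sub>R h) \<bullet> ((x - y) /\<^sub>R h)) (c y)" for y
  have f_meas[measurable]: "f \<in> borel_measurable borel"
    unfolding f_def using W c a
    by (intro borel_measurable_continuous_on_indicator continuous_on_scaled_profile) (auto intro!: continuous_intros)
  have f0: "0 \<le> f y" for y
    using c(2)[of y] l by (auto simp: f_def indicator_def)
  define k where "k u = f (x + h *\<^sub>R u)" for u
  have k_meas: "k \<in> borel_measurable borel" unfolding k_def by measurable
  have k_eq: "k u = indicator W (x + h *\<^sub>R u) * scaled_profile 0 m a (u \<bullet> u) (c (x + h *\<^sub>R u))" for u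
    using h(1) by (simp add: k_def f_def)
  have k_line: "k u = line_deriv 0 m a c x u h" if "u \<in> centred_cube R" for u
    using h(2)[OF that] by (simp add: k_eq)
  have k_out: "k u = 0" if u: "u \<notin> centred_cube R" for u
  proof (cases "x + h *\<^sub>R u \<in> W")
    case True
    have "0 \<le> R" using l by (smt (verit) mult_nonneg_nonpos)
    then have "1 \<le> c (x + h *\<^sub>R u) * R" using c(2)[OF True] l(2) mult_right_mono[of l "c (x + h *\<^sub>R u)" R] by linarith
    then show ?thesis
      using profile_outside_cube[OF u, of "c (x + h *\<^sub>R u)"] c(2)[OF True] l(1)
      by (simp add: k_eq del: scaled_profile.simps)
  qed (simp add: k_eq)
  have cont: "continuous_on (centred_cube R) (\<lambda>u. line_deriv 0 m a c x u h)"
    unfolding line_deriv.simps using h(2) a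
    by (intro continuous_on_scaled_profile continuous_on_compose2[OF c(1)]) (auto intro!: continuous_intros)
  have k_cont: "continuous_on (centred_cube R) k"
    using cont by (rule continuous_on_eq) (simp add: k_line)
  have int: "integral (centred_cube R) (\<lambda>u. line_deriv 0 m a c x u h) = (LINT u|lborel. k u)"
  proof -
    have "integral (centred_cube R) (\<lambda>u. line_deriv 0 m a c x u h) = integral (centred_cube R) k"
      by (rule Henstock_Kurzweil_Integration.integral_cong) (rule k_line[symmetric])
    also have "\<dots> = (LINT u|lborel. k u)"
      by (rule lborel_integral_eq_cube[OF k_cont k_out, symmetric])
    finally show ?thesis .
  qed
  show nonneg: "0 \<le> integral (centred_cube R) (\<lambda>u. line_deriv 0 m a c x u h)"
    unfolding int by (intro Bochner_Integration.integral_nonneg) (simp add: k_def f0)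
  have "(\<integral>\<^sup>+y\<in>W. ennreal (scaled_profile 0 m a (((x - y) /\<^sub>R h) \<bullet> ((x - y) /\<^sub>R h)) (c y)) \<partial>lborel)
     = (\<integral>\<^sup>+y. ennreal (f y) \<partial>lborel)"
    by (intro nn_integral_cong) (auto simp: f_def indicator_def)
  also have "\<dots> = ennreal (\<bar>h\<bar> ^ DIM('a)) * (\<integral>\<^sup>+u. ennreal (k u) \<partial>lborel)"
    unfolding k_def using h by (intro lborel_integral_affine_nn) auto
  also have "(\<integral>\<^sup>+u. ennreal (k u) \<partial>lborel) = ennreal (LINT u|lborel. k u)"
    by (intro nn_integral_eq_integral integrable_vanishing_outside_cube[OF k_cont k_out]) (auto simp: k_def f0)
  finally show "(\<integral>\<^sup>+y\<in>W. ennreal (scaled_profile 0 m a (((x - y) /\<^sub>R h) \<bullet> ((x - y) /\<^sub>R h)) (c y)) \<partial>lborel)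
      = ennreal (h ^ DIM('a) * integral (centred_cube R) (\<lambda>u. line_deriv 0 m a c x u h))"
    unfolding int using h(1) nonneg[unfolded int] by (simp add: ennreal_mult)
qed

lemma nn_integral_product_density_le:
  fixes W :: "'a::euclidean_space set"
  assumes W: "W \<in> sets borel"
    and lam_meas: "lam \<in> borel_measurable (restrict_space lborel W)"
    and rho: "\<And>u v. u \<in> W \<Longrightarrow> v \<in> W \<Longrightarrow> rho u v \<le> C * (lam u * lam v)"
    and lam: "\<And>u. u \<in> W \<Longrightarrow> 0 \<le> lam u"
    and F[measurable]: "F \<in> borel_measurable borel" and F0: "\<And>u. 0 \<le> F u" and C: "0 \<le> C"
  shows "(\<integral>\<^sup>+p\<in>W \<times> W. ennreal (F (fst p) * F (snd p)) * ennreal (rho (fst p) (snd p)) \<partial>lborel)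
     \<le> ennreal C * (\<integral>\<^sup>+u\<in>W. ennreal (F u) * ennreal (lam u) \<partial>lborel)\<^sup>2"
proof -
  define G where "G u = ennreal (F u * (indicator W u *\<^sub>R lam u))" for u
  have "(\<lambda>u. indicator W u *\<^sub>R lam u) \<in> borel_measurable lborel"
    using lam_meas W by (subst (asm) borel_measurable_restrict_space_iff) auto
  then have G[measurable]: "G \<in> borel_measurable borel" unfolding G_def by measurable
  have "(\<integral>\<^sup>+p\<in>W \<times> W. ennreal (F (fst p) * F (snd p)) * ennreal (rho (fst p) (snd p)) \<partial>lborel)
      \<le> (\<integral>\<^sup>+p. ennreal C * (G (fst p) * G (snd p)) \<partial>lborel)"
  proof (intro nn_integral_mono)
    fix p :: "'a \<times> 'a"
    show "ennreal (F (fst p) * F (snd p)) * ennreal (rho (fst p) (snd p)) * indicator (W \<times> W) p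
        \<le> ennreal C * (G (fst p) * G (snd p))"
    proof (cases "p \<in> W \<times> W")
      case True
      then have p: "fst p \<in> W" "snd p \<in> W" by auto
      have "ennreal (F (fst p) * F (snd p)) * ennreal (rho (fst p) (snd p))
         \<le> ennreal (F (fst p) * F (snd p)) * ennreal (C * (lam (fst p) * lam (snd p)))"
        using rho[OF p] by (intro mult_left_mono ennreal_leI) auto
      also have "\<dots> = ennreal (F (fst p) * F (snd p) * (C * (lam (fst p) * lam (snd p))))"
        by (rule ennreal_mult''[symmetric]) (use C lam p in auto)
      also have "\<dots> = ennreal C * (G (fst p) * G (snd p))"
        using C F0 lam[OF p(1)] lam[OF p(2)] p by (simp add: G_def ennreal_mult[symmetric] mult_ac)
      finally show ?thesis using True by simp
    qed simp
  qed
  also have "\<dots> = (\<integral>\<^sup>+p. ennreal C * (G (fst p) * G (snd p)) \<partial>(lborel \<Otimes>\<^sub>M lborel))"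
    by (simp add: lborel_prod)
  also have "\<dots> = (\<integral>\<^sup>+u. \<integral>\<^sup>+v. ennreal C * (G u * G v) \<partial>lborel \<partial>lborel)"
    by (subst lborel.nn_integral_fst[symmetric]) auto
  also have "\<dots> = ennreal C * ((\<integral>\<^sup>+u. G u \<partial>lborel) * (\<integral>\<^sup>+v. G v \<partial>lborel))"
    by (simp add: nn_integral_cmult nn_integral_multc)
  also have "(\<integral>\<^sup>+u. G u \<partial>lborel) = (\<integral>\<^sup>+u\<in>W. ennreal (F u) * ennreal (lam u) \<partial>lborel)"
    using F0 lam by (intro nn_integral_cong) (auto simp: G_def indicator_def ennreal_mult)
  finally show ?thesis by (simp add: power2_eq_square)
qed

lemma iid_point_processes_sum:
  fixes f :: "'a::euclidean_space \<Rightarrow> real"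
  assumes iid: "iid_point_processes M \<Phi> {1..}" and "prob_space M"
    and f: "f \<in> borel_measurable borel" "\<And>y. 0 \<le> f y" and W: "W \<in> sets borel" "bounded W"
  defines "S \<equiv> \<lambda>i \<omega>. \<Sum>y\<in>\<Phi> i \<omega> \<inter> W. f y"
  shows "prob_space.indep_vars M (\<lambda>_. borel) S {1..}"
    and "i \<ge> 1 \<Longrightarrow> has_bochner_integral M (S 1) m \<Longrightarrow> has_bochner_integral M (S i) m"
    and "i \<ge> 1 \<Longrightarrow> has_bochner_integral M (\<lambda>\<omega>. (S 1 \<omega>)\<^sup>2) m \<Longrightarrow> has_bochner_integral M (\<lambda>\<omega>. (S i \<omega>)\<^sup>2) m"
proof -
  interpret prob_space M by fact
  note meas[measurable] = measurable_points_sum[OF f W]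
  show "indep_vars (\<lambda>_. borel) S {1..}"
    unfolding S_def using iid by (intro indep_vars_compose2[OF _ meas]) (auto simp: iid_point_processes_def)
  have \<Phi>: "\<Phi> i \<in> measurable M config_space" if "i \<ge> 1" for i
    using iid that by (auto simp: iid_point_processes_def point_process_def)
  have transfer: "has_bochner_integral M (\<lambda>\<omega>. k (\<Phi> i \<omega>)) m"
    if i: "i \<ge> 1" and k: "k \<in> borel_measurable config_space" and m: "has_bochner_integral M (\<lambda>\<omega>. k (\<Phi> 1 \<omega>)) m"
    for i m and k :: "'a set \<Rightarrow> real"
  proof -
    have "distr M config_space (\<Phi> i) = distr M config_space (\<Phi> 1)"
      using iid i unfolding iid_point_processes_def by (metis atLeast_iff order_refl)
    then show ?thesis
      using m integrable_distr_eq[OF \<Phi>[OF i] k] integrable_distr_eq[OF \<Phi>[of 1] k]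
        integral_distr[OF \<Phi>[OF i] k] integral_distr[OF \<Phi>[of 1] k]
      by (simp add: has_bochner_integral_iff)
  qed
  show "has_bochner_integral M (S i) m" if "i \<ge> 1" "has_bochner_integral M (S 1) m"
    using transfer[OF that(1) meas] that(2) unfolding S_def by simp
  show "has_bochner_integral M (\<lambda>\<omega>. (S i \<omega>)\<^sup>2) m" if "i \<ge> 1" "has_bochner_integral M (\<lambda>\<omega>. (S 1 \<omega>)\<^sup>2) m"
    using transfer[OF that(1), of "\<lambda>x. (\<Sum>y\<in>x \<inter> W. f y)\<^sup>2"] that(2) unfolding S_def by simp
qed

text \<open>An exact identity, valid as soon as \<open>h\<close> is so small that the rescaled cube lies in \<open>W\<close>. The three numbers are the mean
  \<open>m1\<close> of a single summand and the contributions of the diagonal (\<open>m2\<close>) and of the distinct pairs (\<open>m12\<close>) to its second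
  moment. Only a bound is needed for \<open>m12\<close>: after division by \<open>n\<close> it is negligible.\<close>

lemma mse_adaptive_estimator:
  fixes M :: "'w measure" and \<Phi> :: "nat \<Rightarrow> 'w \<Rightarrow> 'a::euclidean_space set"
  assumes W: "open W" "bounded W" and M: "prob_space M"
    and iid: "iid_point_processes M \<Phi> {1..}"
    and intens: "intensity_function_on M (\<Phi> 1) W lam"
    and dens: "product_density_on M (\<Phi> 1) W rho"
    and corr: "\<And>u v. u \<in> W \<Longrightarrow> v \<in> W \<Longrightarrow> rho u v \<le> C * (lam u * lam v)" "0 \<le> C"
    and lam: "continuous_on W (weight lam x0)" "\<And>y. y \<in> W \<Longrightarrow> 0 < lam y" "\<And>y. y \<in> W \<Longrightarrow> l \<le> weight lam x0 y"
    and x0: "x0 \<in> W" and l: "0 < l" "1 \<le> l * R" and \<gamma>: "0 < \<gamma>"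
    and h: "0 < h" "\<And>u. u \<in> centred_cube R \<Longrightarrow> x0 + h *\<^sub>R u \<in> W" and n: "1 \<le> n"
  defines "m1 \<equiv> lam x0 * (integral (centred_cube R) (\<lambda>u. line_deriv 0 (DIM('a) + 2) \<gamma> (weight lam x0) x0 u h)
                  / beta_const TYPE('a) \<gamma>)"
    and "m2 \<equiv> lam x0 * (integral (centred_cube R) (\<lambda>u. line_deriv 0 (2 * DIM('a) + 2) (2 * \<gamma>) (weight lam x0) x0 u h)
                  / (beta_const TYPE('a) \<gamma>)\<^sup>2) / h ^ DIM('a)"
  shows "\<exists>m12. 0 \<le> m12 \<and> m12 \<le> C * m1\<^sup>2 \<and>
     mse M (adaptive_estimator \<gamma> lam W \<Phi> x0 n h) (lam x0) = (m2 + m12 - m1\<^sup>2) / real n + (m1 - lam x0)\<^sup>2"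
proof -
  interpret prob_space M by fact
  let ?c = "weight lam x0" and ?K = "beta_const TYPE('a) \<gamma>" and ?d = "DIM('a)"
  let ?q = "\<lambda>y. ((x0 - y) /\<^sub>R h) \<bullet> ((x0 - y) /\<^sub>R h)"
  have K: "0 < ?K" using \<gamma> by (rule beta_const_pos)
  have c0: "0 < ?c y" if "y \<in> W" for y using lam(3)[OF that] l by simp
  \<comment> \<open>The exponent \<open>d + 2\<close> in \<open>g\<^sub>u\<close> arises here: \<open>d\<close> from the estimator and \<open>2\<close> from the intensity.\<close>
  have lam_c: "lam y = lam x0 * (?c y)\<^sup>2" if "y \<in> W" for y
    using lam(2)[OF that] lam(2)[OF x0] by (simp add: weight_def)
  define F where "F y = indicator W y *\<^sub>R (?c y ^ ?d / h ^ ?d * beta_kernel \<gamma> (?c y *\<^sub>R ((x0 - y) /\<^sub>R h)))" for y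
  have F_eq: "F y = scaled_profile 0 ?d \<gamma> (?q y) (?c y) / (h ^ ?d * ?K)" if "y \<in> W" for y
    using that unfolding F_def beta_kernel_eq_profile by simp
  have F_eq': "F = (\<lambda>y. indicator W y *\<^sub>R (scaled_profile 0 ?d \<gamma> (?q y) (?c y) / (h ^ ?d * ?K)))"
    by (auto simp: fun_eq_iff F_eq indicator_def) (simp add: F_def)
  have F_meas: "F \<in> borel_measurable borel"
    unfolding F_eq' using W lam(1) h(1) K \<gamma>
    by (intro borel_measurable_continuous_on_indicator continuous_on_divide continuous_on_scaled_profile)
       (auto intro!: continuous_intros)
  have F0: "0 \<le> F y" for y
    using F_eq[of y] c0[of y] K h(1) by (cases "y \<in> W") (auto simp: F_def)
  have Wb: "W \<in> sets borel" using W by simp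
  have profile:
    "(\<integral>\<^sup>+y\<in>W. ennreal (scaled_profile 0 m a (?q y) (?c y)) \<partial>lborel)
      = ennreal (h ^ ?d * integral (centred_cube R) (\<lambda>u. line_deriv 0 m a ?c x0 u h))"
    "0 \<le> integral (centred_cube R) (\<lambda>u. line_deriv 0 m a ?c x0 u h)" if "0 < a" for m a
    by (rule nn_integral_rescaled_profile[where l=l]; fact)+
  have scaled: "(\<integral>\<^sup>+u\<in>W. ennreal (k * scaled_profile 0 m a (?q u) (?c u)) \<partial>lborel)
      = ennreal (k * (h ^ ?d * integral (centred_cube R) (\<lambda>u. line_deriv 0 m a ?c x0 u h)))"
    if k: "0 \<le> k" and a: "0 < a" for k m a
  proof -
    have meas: "(\<lambda>u. ennreal (indicator W u *\<^sub>R scaled_profile 0 m a (?q u) (?c u))) \<in> borel_measurable borel"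
      using W lam(1) h(1) a
      by (intro measurable_compose[OF _ measurable_ennreal] borel_measurable_continuous_on_indicator continuous_on_scaled_profile)
         (auto intro!: continuous_intros)
    have "(\<integral>\<^sup>+u\<in>W. ennreal (k * scaled_profile 0 m a (?q u) (?c u)) \<partial>lborel)
      = (\<integral>\<^sup>+u. ennreal k * ennreal (indicator W u *\<^sub>R scaled_profile 0 m a (?q u) (?c u)) \<partial>lborel)"
      using k by (intro nn_integral_cong) (auto simp: indicator_def ennreal_mult')
    also have "\<dots> = ennreal k * (\<integral>\<^sup>+u. ennreal (indicator W u *\<^sub>R scaled_profile 0 m a (?q u) (?c u)) \<partial>lborel)"
      using meas by (intro nn_integral_cmult) simp
    also have "(\<integral>\<^sup>+u. ennreal (indicator W u *\<^sub>R scaled_profile 0 m a (?q u) (?c u)) \<partial>lborel)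
       = (\<integral>\<^sup>+u\<in>W. ennreal (scaled_profile 0 m a (?q u) (?c u)) \<partial>lborel)"
      by (intro nn_integral_cong) (auto simp: indicator_def)
    also have "\<dots> = ennreal (h ^ ?d * integral (centred_cube R) (\<lambda>u. line_deriv 0 m a ?c x0 u h))"
      using a by (rule profile(1))
    finally show ?thesis using k by (simp only: ennreal_mult')
  qed
  have m1: "(\<integral>\<^sup>+u\<in>W. ennreal (F u) * ennreal (lam u) \<partial>lborel) = ennreal m1"
  proof -
    have "(\<integral>\<^sup>+u\<in>W. ennreal (F u) * ennreal (lam u) \<partial>lborel)
        = (\<integral>\<^sup>+u\<in>W. ennreal (lam x0 / (h ^ ?d * ?K) * scaled_profile 0 (?d + 2) \<gamma> (?q u) (?c u)) \<partial>lborel)"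
    proof (intro set_nn_integral_cong)
      fix u assume "u \<in> space lborel \<inter> W"
      then have u: "u \<in> W" by simp
      have "F u * lam u = lam x0 / (h ^ ?d * ?K) * scaled_profile 0 (?d + 2) \<gamma> (?q u) (?c u)"
        by (simp add: F_eq[OF u] lam_c[OF u] power_add power2_eq_square)
      then show "ennreal (F u) * ennreal (lam u)
          = ennreal (lam x0 / (h ^ ?d * ?K) * scaled_profile 0 (?d + 2) \<gamma> (?q u) (?c u))"
        using lam(2)[OF u] by (simp only: ennreal_mult''[symmetric] less_imp_le)
    qed simp_all
    also have "\<dots> = ennreal (lam x0 / (h ^ ?d * ?K) * (h ^ ?d * integral (centred_cube R) (\<lambda>u. line_deriv 0 (?d + 2) \<gamma> ?c x0 u h)))"
      using lam(2)[OF x0] h(1) K by (intro scaled \<gamma>) simp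
    also have "lam x0 / (h ^ ?d * ?K) * (h ^ ?d * integral (centred_cube R) (\<lambda>u. line_deriv 0 (?d + 2) \<gamma> ?c x0 u h)) = m1"
      using h(1) K by (simp add: m1_def)
    finally show ?thesis .
  qed
  have m1_0: "0 \<le> m1"
    unfolding m1_def using less_imp_le[OF lam(2)[OF x0]] less_imp_le[OF K]
    by (intro mult_nonneg_nonneg divide_nonneg_nonneg profile(2) \<gamma>)
  have m2: "(\<integral>\<^sup>+u\<in>W. ennreal ((F u)\<^sup>2) * ennreal (lam u) \<partial>lborel) = ennreal m2"
  proof -
    have "(\<integral>\<^sup>+u\<in>W. ennreal ((F u)\<^sup>2) * ennreal (lam u) \<partial>lborel)
        = (\<integral>\<^sup>+u\<in>W. ennreal (lam x0 / (h ^ ?d * ?K)\<^sup>2 * scaled_profile 0 (2 * ?d + 2) (2 * \<gamma>) (?q u) (?c u)) \<partial>lborel)"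
    proof (intro set_nn_integral_cong)
      fix u assume "u \<in> space lborel \<inter> W"
      then have u: "u \<in> W" by simp
      have "(F u)\<^sup>2 * lam u = lam x0 / (h ^ ?d * ?K)\<^sup>2 * scaled_profile 0 (2 * ?d + 2) (2 * \<gamma>) (?q u) (?c u)"
        by (simp add: F_eq[OF u] lam_c[OF u] power_divide power_mult_distrib power_add power_mult powr_add[symmetric] power2_eq_square)
      then show "ennreal ((F u)\<^sup>2) * ennreal (lam u)
          = ennreal (lam x0 / (h ^ ?d * ?K)\<^sup>2 * scaled_profile 0 (2 * ?d + 2) (2 * \<gamma>) (?q u) (?c u))"
        using lam(2)[OF u] by (simp only: ennreal_mult''[symmetric] zero_le_power2 less_imp_le)
    qed simp_all
    also have "\<dots> = ennreal (lam x0 / (h ^ ?d * ?K)\<^sup>2 * (h ^ ?d * integral (centred_cube R) (\<lambda>u. line_deriv 0 (2 * ?d + 2) (2 * \<gamma>) ?c x0 u h)))"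
      using lam(2)[OF x0] h(1) K \<gamma> by (intro scaled) simp_all
    also have "lam x0 / (h ^ ?d * ?K)\<^sup>2 * (h ^ ?d * integral (centred_cube R) (\<lambda>u. line_deriv 0 (2 * ?d + 2) (2 * \<gamma>) ?c x0 u h)) = m2"
      using h(1) K by (simp add: m2_def power_mult_distrib power2_eq_square)
    finally show ?thesis .
  qed
  have m2_0: "0 \<le> m2"
    unfolding m2_def using less_imp_le[OF lam(2)[OF x0]] less_imp_le[OF K] h(1) \<gamma>
    by (intro mult_nonneg_nonneg divide_nonneg_nonneg profile(2)) auto
  let ?N = "\<integral>\<^sup>+p\<in>W \<times> W. ennreal (F (fst p) * F (snd p)) * ennreal (rho (fst p) (snd p)) \<partial>lborel"
  have "?N \<le> ennreal C * (\<integral>\<^sup>+u\<in>W. ennreal (F u) * ennreal (lam u) \<partial>lborel)\<^sup>2"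
    using intens lam(2) corr
    by (intro nn_integral_product_density_le Wb F_meas F0) (auto simp: intensity_function_on_def less_imp_le)
  also have "\<dots> = ennreal (C * m1\<^sup>2)"
    using corr(2) m1_0 by (simp add: m1 ennreal_mult power2_eq_square)
  finally have N_le: "?N \<le> ennreal (C * m1\<^sup>2)" .
  define m12 where "m12 = enn2real ?N"
  have m12: "?N = ennreal m12" "0 \<le> m12" "m12 \<le> C * m1\<^sup>2"
  proof -
    have "?N < \<top>" using N_le by (rule le_less_trans) simp
    then show "?N = ennreal m12" by (simp add: m12_def)
    then show "m12 \<le> C * m1\<^sup>2" using N_le corr(2) by (simp add: ennreal_le_iff)
  qed (simp add: m12_def)
  have "point_process M (\<Phi> 1)" using iid by (auto simp: iid_point_processes_def)
  note mom = points_sum_moments[OF Wb W(2) this intens dens F_meas F0 m1 m1_0 m2 m2_0 m12(1,2)]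
  note sums = iid_point_processes_sum[OF iid M F_meas F0 Wb W(2)]
  have est: "adaptive_estimator \<gamma> lam W \<Phi> x0 n h = (\<lambda>\<omega>. 1 / real n * (\<Sum>i\<in>{1..n}. \<Sum>y\<in>\<Phi> i \<omega> \<inter> W. F y))"
    unfolding adaptive_estimator_def by (intro ext arg_cong2[where f="(*)"] refl sum.cong) (simp add: F_def)
  have "mse M (adaptive_estimator \<gamma> lam W \<Phi> x0 n h) (lam x0) = (m2 + m12 - m1\<^sup>2) / real n + (m1 - lam x0)\<^sup>2"
    unfolding est by (rule mse_average_of_indep[OF sums(1) sums(2)[OF _ mom(1)] sums(3)[OF _ mom(2)] n])
  with m12 show ?thesis by blast
qed

section \<open>The optimal bandwidth\<close>

text \<open>With \<open>b = b0 s\<close> and \<open>R / b0\<^sup>d = (8 / d) P b0\<^sup>8\<close>, the difference to the value at \<open>b0\<close> is \<open>P b0\<^sup>8\<close> times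
  \<open>(s\<^sup>8 - 1) + (8 / d) (s\<^sup>-\<^sup>d - 1)\<close>. By \<open>ln x \<le> x - 1\<close> this is at least \<open>8 ln s - 8 ln s = 0\<close>, with equality only for
  \<open>s = 1\<close>.\<close>

lemma is_arg_min_bias_variance:
  fixes P R :: real and d :: nat
  assumes P: "0 < P" and R: "0 < R" and d: "0 < d"
  shows "is_arg_min (\<lambda>b. P * b ^ 8 + R / b ^ d) (\<lambda>b. b > 0) b
     \<longleftrightarrow> b = (real d * R / (8 * P)) powr (1 / (real d + 8))"
proof -
  define b0 where "b0 = (real d * R / (8 * P)) powr (1 / (real d + 8))"
  let ?f = "\<lambda>b. P * b ^ 8 + R / b ^ d"
  have b0: "0 < b0" using assms by (simp add: b0_def)
  have "b0 ^ (d + 8) = b0 powr (real d + 8)"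
    using b0 by (simp add: powr_realpow[symmetric])
  also have "\<dots> = real d * R / (8 * P)"
    using assms by (simp add: b0_def powr_powr)
  finally have b0_pow: "R / b0 ^ d = 8 / real d * (P * b0 ^ 8)"
    using assms b0 by (simp add: field_simps power_add)
  have less: "?f b0 < ?f b" if b: "0 < b" "b \<noteq> b0" for b
  proof -
    define s where "s = b / b0"
    have s: "0 < s" "s \<noteq> 1" "b = b0 * s" using b b0 by (auto simp: s_def)
    have "8 * ln s < s ^ 8 - 1"
    proof -
      have "s ^ 8 \<noteq> 1" using s power_eq_imp_eq_base[of s 8 1] by auto
      then have "ln (s ^ 8) < s ^ 8 - 1"
        using s ln_le_minus_one[of "s ^ 8"] ln_eq_minus_one[of "s ^ 8"] by force
      then show ?thesis using s by (simp add: ln_realpow)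
    qed
    moreover have "- real d * ln s \<le> 1 / s ^ d - 1"
      using s ln_le_minus_one[of "1 / s ^ d"] by (simp add: ln_div ln_realpow)
    then have "8 / real d * (- real d * ln s) \<le> 8 / real d * (1 / s ^ d - 1)"
      using d by (intro mult_left_mono) auto
    ultimately have "0 < (s ^ 8 - 1) + 8 / real d * (1 / s ^ d - 1)"
      using d by simp
    then have "0 < P * b0 ^ 8 * ((s ^ 8 - 1) + 8 / real d * (1 / s ^ d - 1))"
      using P b0 by (intro mult_pos_pos) auto
    also have "\<dots> = P * b0 ^ 8 * s ^ 8 - P * b0 ^ 8 + 8 / real d * (P * b0 ^ 8) * (1 / s ^ d - 1)"
      by (simp add: algebra_simps)
    also have "\<dots> = P * b0 ^ 8 * s ^ 8 - P * b0 ^ 8 + R / b0 ^ d * (1 / s ^ d - 1)"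
      by (simp only: b0_pow)
    also have "\<dots> = ?f b - ?f b0"
      by (simp add: s(3) power_mult_distrib algebra_simps)
    finally show ?thesis by simp
  qed
  show ?thesis
    unfolding is_arg_min_def b0_def[symmetric] using less b0 by (metis less_irrefl less_asym)
qed

section \<open>Bias and variance asymptotics\<close>

theorem corollary2:
  fixes M :: "'w measure"
    and \<Phi> :: "nat \<Rightarrow> 'w \<Rightarrow> 'a::euclidean_space set"
    and W :: "'a set"
    and lam :: "'a \<Rightarrow> real"
    and rho :: "'a \<Rightarrow> 'a \<Rightarrow> real"
    and lam_lo lam_hi \<gamma> :: real
    and h :: "nat \<Rightarrow> real"
    and x0 :: 'a
  assumes "open W" and "bounded W" and "W \<noteq> {}"
    and "prob_space M"
    and "iid_point_processes M \<Phi> {1..}"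
    and "locally_finite_factorial_moments M (\<Phi> 1)"
    and "intensity_function_on M (\<Phi> 1) W lam"
    and "product_density_on M (\<Phi> 1) W rho"
    and "bounded ((\<lambda>(u, v). pair_correlation lam rho u v) ` (W \<times> W))"
    and "0 < lam_lo" and "lam_lo < lam_hi"
    and "\<And>x. x \<in> W \<Longrightarrow> lam x \<in> {lam_lo<..<lam_hi}"
    and "times_cont_differentiable_on 5 lam W"
    and "bounded_partials_on 5 lam W"
    and "\<gamma> > 5"
    and "\<And>n. n \<ge> 1 \<Longrightarrow> h n > 0"
    and "h \<longlonglongrightarrow> 0"
    and "filterlim (\<lambda>n. real n * h n ^ DIM('a)) at_top sequentially"
    and "x0 \<in> W"
  shows "(\<exists>r1 r2. r1 \<in> o(\<lambda>n. h n ^ 8) \<and>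
            r2 \<in> O(\<lambda>n. 1 / (real n * h n ^ (DIM('a) - 1))) \<and>
            (\<forall>n\<ge>1. mse M (adaptive_estimator \<gamma> lam W \<Phi> x0 n (h n)) (lam x0)
               = (lam x0)\<^sup>2 * (LINT u|lborel. A_fun \<gamma> lam x0 u)\<^sup>2 * h n ^ 8
                 + lam x0 * beta_Q TYPE('a) \<gamma> / (real n * h n ^ DIM('a))
                 + r1 n + r2 n)) \<and>
         ((LINT u|lborel. A_fun \<gamma> lam x0 u) \<noteq> 0 \<longrightarrow>
          (\<forall>n\<ge>1. \<forall>h'. is_arg_min
             (\<lambda>b. (lam x0)\<^sup>2 * (LINT u|lborel. A_fun \<gamma> lam x0 u)\<^sup>2 * b ^ 8
                 + lam x0 * beta_Q TYPE('a) \<gamma> / (real n * b ^ DIM('a)))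
             (\<lambda>b. b > 0) h'
           \<longleftrightarrow> h' = 1 / real n powr (1 / (real DIM('a) + 8))
                 * (real DIM('a) * beta_Q TYPE('a) \<gamma>
                    / (8 * lam x0 * (LINT u|lborel. A_fun \<gamma> lam x0 u)\<^sup>2))
                   powr (1 / (real DIM('a) + 8))))"
proof (rule conjI)
  let ?c = "weight lam x0" and ?K = "beta_const TYPE('a) \<gamma>" and ?d = "DIM('a)"
  let ?A = "LINT u|lborel. A_fun \<gamma> lam x0 u" and ?Q = "beta_Q TYPE('a) \<gamma>"
  note W = \<open>open W\<close> and x0 = \<open>x0 \<in> W\<close>
  have lam_pos: "0 < lam y" if "y \<in> W" for y using assms(12)[OF that] assms(10) by auto
  have lam0: "0 < lam x0" using lam_pos[OF x0] .
  have \<gamma>: "4 < \<gamma>" "4 < 2 * \<gamma>" "0 < \<gamma>" using assms(15) by auto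
  have K: "0 < ?K" and Q: "0 < ?Q" using \<gamma>(3) by (auto intro: beta_const_pos beta_Q_pos)
  have c4: "times_cont_differentiable_on 4 ?c W"
    using times_cont_differentiable_on_weight[OF W assms(13) lam_pos]
    by (rule times_cont_differentiable_on_mono) auto
  then have c_cont: "continuous_on W ?c"
    by (auto dest: times_cont_differentiable_on_mono[where j=0] simp: times_cont_differentiable_on_0)
  have c1: "?c x0 = 1" using lam0 by (simp add: weight_def)
  define l where "l = sqrt (lam_lo / lam x0)"
  \<comment> \<open>The rescaled kernel vanishes once \<open>c |u| \<ge> 1\<close>, hence outside the cube of half side length \<open>1 / l\<close>, where \<open>l\<close> is a
    lower bound of \<open>c\<close> on \<open>W\<close>.\<close>
  define R where "R = 1 / l"
  have l: "0 < l" "l \<le> ?c y" if "y \<in> W" for y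
    using assms(12)[OF that] assms(10) lam0 by (auto simp: l_def weight_def intro!: divide_right_mono)
  have R: "1 \<le> R" "1 \<le> l * R"
    using l[OF x0] by (auto simp: R_def c1)
  obtain \<delta> where \<delta>: "0 < \<delta>" "\<And>t u. \<bar>t\<bar> < \<delta> \<Longrightarrow> u \<in> centred_cube R \<Longrightarrow> x0 + t *\<^sub>R u \<in> W"
    using line_stays_in_open[OF W x0] by metis
  obtain C where C: "0 \<le> C" "\<And>u v. u \<in> W \<Longrightarrow> v \<in> W \<Longrightarrow> \<bar>pair_correlation lam rho u v\<bar> \<le> C"
  proof -
    obtain C where C: "\<And>p. p \<in> (\<lambda>(u, v). pair_correlation lam rho u v) ` (W \<times> W) \<Longrightarrow> norm p \<le> C"
      using assms(9) unfolding bounded_iff by blast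
    have *: "\<bar>pair_correlation lam rho u v\<bar> \<le> C" if "u \<in> W" "v \<in> W" for u v
      using C[of "pair_correlation lam rho u v"] that by force
    then have "0 \<le> C" using x0 by (meson abs_ge_zero order_trans)
    with * that show thesis by blast
  qed
  have corr: "rho u v \<le> C * (lam u * lam v)" if "u \<in> W" "v \<in> W" for u v
    using C(2)[OF that] lam_pos[OF that(1)] lam_pos[OF that(2)]
    by (simp add: pair_correlation_def abs_le_iff pos_divide_le_eq)

  define J where "J m a t = integral (centred_cube R) (\<lambda>u. line_deriv 0 m a ?c x0 u t)" for m a t
  define m1 where "m1 t = lam x0 * (J (?d + 2) \<gamma> t / ?K)" for t
  define V where "V t = J (2 * ?d + 2) (2 * \<gamma>) t / ?K\<^sup>2" for t
  have h_lim: "filterlim h (at_right 0) sequentially"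
    unfolding filterlim_at
    using assms(16,17) by (auto intro!: eventually_mono[OF eventually_ge_at_top[of 1]] simp: less_imp_neq[symmetric])
  have bias_lim: "((\<lambda>t. (J (?d + 2) \<gamma> t / ?K - 1) / t ^ 4) \<longlongrightarrow> ?A) (at_right 0)"
    unfolding J_def by (rule bias_expansion[OF W x0 c4 c1 \<gamma>(1) R(1)])
  have V0: "V 0 = ?Q"
    unfolding V_def J_def beta_Q_eq_LINT[OF \<gamma>(3), of "2 * ?d + 2", where 'a='a]
    using line_deriv_0_LINT(2)[OF c4 x0 c1 \<gamma>(2) R(1), of 0 "2 * ?d + 2"] c1
    by (simp del: scaled_profile.simps)
  obtain V' where V': "(V has_field_derivative V') (at 0)"
    using DERIV_cdivide[OF DERIV_integral_line_deriv[OF W x0 c4 \<gamma>(2)], of R "2 * ?d + 2" "?K\<^sup>2"]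
    unfolding V_def J_def by blast
  \<comment> \<open>\<open>V\<close> is differentiable at zero, so replacing \<open>V (h n)\<close> by \<open>Q\<close> costs \<open>O(h n)\<close>, which is the gain from
    \<open>h ^ d\<close> to \<open>h ^ (d - 1)\<close> in the error term.\<close>
  have V_lim: "((\<lambda>t. (V t - ?Q) / t) \<longlongrightarrow> V') (at_right 0)"
    using V' unfolding has_field_derivative_iff V0
    by (simp add: tendsto_mono[OF at_le[of "{0<..}" UNIV]])
  have m1_lim: "((\<lambda>t. (m1 t - lam x0) / t ^ 4) \<longlongrightarrow> lam x0 * ?A) (at_right 0)"
  proof -
    have "((\<lambda>t. lam x0 * ((J (?d + 2) \<gamma> t / ?K - 1) / t ^ 4)) \<longlongrightarrow> lam x0 * ?A) (at_right 0)"
      by (intro tendsto_mult tendsto_const bias_lim)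
    then show ?thesis by (simp add: m1_def right_diff_distrib)
  qed
  define T where "T n = mse M (adaptive_estimator \<gamma> lam W \<Phi> x0 n (h n)) (lam x0)" for n
  have small: "eventually (\<lambda>n. 1 \<le> n \<and> 0 < h n \<and> h n < \<delta> \<and> h n < 1) sequentially"
  proof -
    have "eventually (\<lambda>n. h n < min \<delta> 1) sequentially"
      using order_tendstoD(2)[OF assms(17), of "min \<delta> 1"] \<delta>(1) by simp
    then show ?thesis
      using eventually_ge_at_top[of 1] by eventually_elim (use assms(16) in auto)
  qed
  have mse_T: "\<exists>m12. 0 \<le> m12 \<and> m12 \<le> C * (m1 (h n))\<^sup>2 \<and>
      T n = (lam x0 * V (h n) / h n ^ ?d + m12 - (m1 (h n))\<^sup>2) / real n + (m1 (h n) - lam x0)\<^sup>2"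
    if "1 \<le> n \<and> 0 < h n \<and> h n < \<delta>" for n
    using mse_adaptive_estimator[OF W assms(2,4,5,7,8) corr C(1) c_cont lam_pos l(2) x0 l(1)[OF x0] R(2) \<gamma>(3), of "h n" n] \<delta>(2) that
    by (simp add: T_def m1_def V_def J_def del: line_deriv.simps)
  have "\<forall>n. \<exists>m12. 1 \<le> n \<and> 0 < h n \<and> h n < \<delta> \<longrightarrow> 0 \<le> m12 \<and> m12 \<le> C * (m1 (h n))\<^sup>2 \<and>
      T n = (lam x0 * V (h n) / h n ^ ?d + m12 - (m1 (h n))\<^sup>2) / real n + (m1 (h n) - lam x0)\<^sup>2"
    using mse_T by blast
  then obtain m12 where m12_all: "\<forall>n. 1 \<le> n \<and> 0 < h n \<and> h n < \<delta> \<longrightarrow> 0 \<le> m12 n \<and> m12 n \<le> C * (m1 (h n))\<^sup>2 \<and>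
      T n = (lam x0 * V (h n) / h n ^ ?d + m12 n - (m1 (h n))\<^sup>2) / real n + (m1 (h n) - lam x0)\<^sup>2"
    by (rule choice[THEN exE])
  then have m12: "0 \<le> m12 n" "m12 n \<le> C * (m1 (h n))\<^sup>2"
    "T n = (lam x0 * V (h n) / h n ^ ?d + m12 n - (m1 (h n))\<^sup>2) / real n + (m1 (h n) - lam x0)\<^sup>2"
    if "1 \<le> n" "0 < h n" "h n < \<delta>" for n
    using that by blast+

  define r1 where "r1 n = (m1 (h n) - lam x0)\<^sup>2 - (lam x0)\<^sup>2 * ?A\<^sup>2 * h n ^ 8" for n
  \<comment> \<open>The remainders are defined for all \<open>n\<close> so that the identity is exact; the expansions bound them for large \<open>n\<close>.\<close>
  define r2 where "r2 n = T n - (lam x0)\<^sup>2 * ?A\<^sup>2 * h n ^ 8 - lam x0 * ?Q / (real n * h n ^ ?d) - r1 n" for n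
  have r1: "r1 \<in> o(\<lambda>n. h n ^ 8)"
  proof (rule smalloI_tendsto)
    have "((\<lambda>n. ((m1 (h n) - lam x0) / h n ^ 4)\<^sup>2 - (lam x0 * ?A)\<^sup>2) \<longlongrightarrow> (lam x0 * ?A)\<^sup>2 - (lam x0 * ?A)\<^sup>2) sequentially"
      by (intro tendsto_intros filterlim_compose[OF m1_lim h_lim])
    then have "((\<lambda>n. ((m1 (h n) - lam x0) / h n ^ 4)\<^sup>2 - (lam x0 * ?A)\<^sup>2) \<longlongrightarrow> 0) sequentially" by simp
    then show "((\<lambda>n. r1 n / h n ^ 8) \<longlongrightarrow> 0) sequentially"
    proof (rule Lim_transform_eventually)
      show "eventually (\<lambda>n. ((m1 (h n) - lam x0) / h n ^ 4)\<^sup>2 - (lam x0 * ?A)\<^sup>2 = r1 n / h n ^ 8) sequentially"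
        using small
      proof eventually_elim
        case (elim n)
        have "((m1 (h n) - lam x0) / h n ^ 4)\<^sup>2 = (m1 (h n) - lam x0)\<^sup>2 / h n ^ 8"
          by (simp only: power_divide power_mult[symmetric]) simp
        moreover have "r1 n / h n ^ 8 = (m1 (h n) - lam x0)\<^sup>2 / h n ^ 8 - (lam x0 * ?A)\<^sup>2"
          unfolding r1_def diff_divide_distrib power_mult_distrib using elim by simp
        ultimately show ?case by simp
      qed
    qed
    show "eventually (\<lambda>n. h n ^ 8 \<noteq> 0) sequentially" using small by eventually_elim auto
  qed
  have V_bound: "eventually (\<lambda>n. \<bar>(V (h n) - ?Q) / h n\<bar> < \<bar>V'\<bar> + 1) sequentially"
    using order_tendstoD(2)[OF tendsto_rabs[OF filterlim_compose[OF V_lim h_lim]], of "\<bar>V'\<bar> + 1"] by simp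
  have "((\<lambda>n. (m1 (h n) - lam x0) / h n ^ 4 * h n ^ 4 + lam x0) \<longlongrightarrow> lam x0 * ?A * 0 ^ 4 + lam x0) sequentially"
    by (intro tendsto_intros filterlim_compose[OF m1_lim h_lim] assms(17))
  then have "((\<lambda>n. (m1 (h n) - lam x0) / h n ^ 4 * h n ^ 4 + lam x0) \<longlongrightarrow> lam x0) sequentially" by simp
  then have "((\<lambda>n. m1 (h n)) \<longlongrightarrow> lam x0) sequentially"
  proof (rule Lim_transform_eventually)
    show "eventually (\<lambda>n. (m1 (h n) - lam x0) / h n ^ 4 * h n ^ 4 + lam x0 = m1 (h n)) sequentially"
      using small by eventually_elim simp
  qed
  then have m1_bound: "eventually (\<lambda>n. (m1 (h n))\<^sup>2 < (lam x0)\<^sup>2 + 1) sequentially"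
    by (intro order_tendstoD(2)[OF tendsto_power]) auto
  have r2: "r2 \<in> O(\<lambda>n. 1 / (real n * h n ^ (?d - 1)))"
  proof (rule bigoI)
    let ?B = "lam x0 * (\<bar>V'\<bar> + 1) + (C + 1) * ((lam x0)\<^sup>2 + 1)"
    show "eventually (\<lambda>n. norm (r2 n) \<le> ?B * norm (1 / (real n * h n ^ (?d - 1)))) sequentially"
      using small V_bound m1_bound
    proof eventually_elim
      case (elim n)
      then have n: "1 \<le> n" "0 < h n" "h n < \<delta>" "h n < 1" by auto
      have hd: "h n ^ ?d = h n * h n ^ (?d - 1)"
        using power_Suc[of "h n" "?d - 1"] by simp
      have hd1: "0 < h n ^ (?d - 1)" "h n ^ (?d - 1) \<le> 1" using n by (auto intro: power_le_one)
      have "r2 n = lam x0 * ((V (h n) - ?Q) / h n) / (real n * h n ^ (?d - 1)) + (m12 n - (m1 (h n))\<^sup>2) / real n"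
        using n unfolding r2_def r1_def m12(3)[OF n(1-3)] hd by (simp add: field_simps)
      also have "norm \<dots> \<le> lam x0 * (\<bar>V'\<bar> + 1) / (real n * h n ^ (?d - 1))
          + (C + 1) * ((lam x0)\<^sup>2 + 1) / (real n * h n ^ (?d - 1))"
      proof (rule norm_triangle_mono)
        have "lam x0 * \<bar>(V (h n) - ?Q) / h n\<bar> \<le> lam x0 * (\<bar>V'\<bar> + 1)"
          using elim lam0 by (intro mult_left_mono) auto
        then have "lam x0 * \<bar>(V (h n) - ?Q) / h n\<bar> / (real n * h n ^ (?d - 1))
            \<le> lam x0 * (\<bar>V'\<bar> + 1) / (real n * h n ^ (?d - 1))"
          using n hd1 by (intro divide_right_mono) auto
        then show "norm (lam x0 * ((V (h n) - ?Q) / h n) / (real n * h n ^ (?d - 1)))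
            \<le> lam x0 * (\<bar>V'\<bar> + 1) / (real n * h n ^ (?d - 1))"
          using n hd1 lam0 by (simp add: abs_mult)
        have "\<bar>m12 n - (m1 (h n))\<^sup>2\<bar> \<le> (C + 1) * (m1 (h n))\<^sup>2"
          using m12(1,2)[OF n(1-3)] zero_le_power2[of "m1 (h n)"]
          by (simp only: distrib_right mult_1_left)
        also have "\<dots> \<le> (C + 1) * ((lam x0)\<^sup>2 + 1)"
          using elim C(1) by (intro mult_left_mono) auto
        finally have B: "\<bar>m12 n - (m1 (h n))\<^sup>2\<bar> \<le> (C + 1) * ((lam x0)\<^sup>2 + 1)" .
        have "norm ((m12 n - (m1 (h n))\<^sup>2) / real n) \<le> (C + 1) * ((lam x0)\<^sup>2 + 1) / real n"
          using B n by (simp add: divide_right_mono)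
        also have "\<dots> \<le> (C + 1) * ((lam x0)\<^sup>2 + 1) / (real n * h n ^ (?d - 1))"
          using hd1 n C(1) by (intro divide_left_mono) (auto simp: mult_le_cancel_left1)
        finally show "norm ((m12 n - (m1 (h n))\<^sup>2) / real n)
            \<le> (C + 1) * ((lam x0)\<^sup>2 + 1) / (real n * h n ^ (?d - 1))" .
      qed
      also have "\<dots> = ?B * norm (1 / (real n * h n ^ (?d - 1)))"
        using n hd1 by (simp add: add_divide_distrib)
      finally show ?case .
    qed
  qed
  show "\<exists>r1 r2. r1 \<in> o(\<lambda>n. h n ^ 8) \<and>
            r2 \<in> O(\<lambda>n. 1 / (real n * h n ^ (DIM('a) - 1))) \<and>
            (\<forall>n\<ge>1. mse M (adaptive_estimator \<gamma> lam W \<Phi> x0 n (h n)) (lam x0)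
               = (lam x0)\<^sup>2 * ?A\<^sup>2 * h n ^ 8 + lam x0 * ?Q / (real n * h n ^ DIM('a)) + r1 n + r2 n)"
    using r1 r2 by (intro exI[of _ r1] exI[of _ r2]) (simp add: r2_def T_def)

  show "?A \<noteq> 0 \<longrightarrow>
          (\<forall>n\<ge>1. \<forall>h'. is_arg_min
             (\<lambda>b. (lam x0)\<^sup>2 * ?A\<^sup>2 * b ^ 8 + lam x0 * ?Q / (real n * b ^ DIM('a))) (\<lambda>b. b > 0) h'
           \<longleftrightarrow> h' = 1 / real n powr (1 / (real DIM('a) + 8))
                 * (real DIM('a) * ?Q / (8 * lam x0 * ?A\<^sup>2)) powr (1 / (real DIM('a) + 8)))"
  proof (intro impI allI)
    fix n :: nat and h' :: real
    assume A: "?A \<noteq> 0" and n: "1 \<le> n"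
    have "real ?d * (lam x0 * ?Q / real n) / (8 * ((lam x0)\<^sup>2 * ?A\<^sup>2))
        = 1 / real n * (real ?d * ?Q / (8 * lam x0 * ?A\<^sup>2))"
      using lam0 n by (simp add: power2_eq_square)
    then have "(real ?d * (lam x0 * ?Q / real n) / (8 * ((lam x0)\<^sup>2 * ?A\<^sup>2))) powr (1 / (real ?d + 8))
        = 1 / real n powr (1 / (real ?d + 8)) * (real ?d * ?Q / (8 * lam x0 * ?A\<^sup>2)) powr (1 / (real ?d + 8))"
      using n Q lam0 by (simp only: powr_mult powr_divide) (simp add: powr_mult powr_divide)
    moreover have "(\<lambda>b. (lam x0)\<^sup>2 * ?A\<^sup>2 * b ^ 8 + lam x0 * ?Q / (real n * b ^ DIM('a)))
        = (\<lambda>b. (lam x0)\<^sup>2 * ?A\<^sup>2 * b ^ 8 + (lam x0 * ?Q / real n) / b ^ DIM('a))" by simp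
    ultimately show "is_arg_min
             (\<lambda>b. (lam x0)\<^sup>2 * ?A\<^sup>2 * b ^ 8 + lam x0 * ?Q / (real n * b ^ DIM('a))) (\<lambda>b. b > 0) h'
           \<longleftrightarrow> h' = 1 / real n powr (1 / (real DIM('a) + 8))
                 * (real DIM('a) * ?Q / (8 * lam x0 * ?A\<^sup>2)) powr (1 / (real DIM('a) + 8))"
      using is_arg_min_bias_variance[of "(lam x0)\<^sup>2 * ?A\<^sup>2" "lam x0 * ?Q / real n" ?d h'] A lam0 Q n
      by simp
  qed
qed

end
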